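(* Let $\mathcal H$ be a complex separable Hilbert space (possibly finite-dimensional) and let $\mathcal S\subseteq\mathcal B(\mathcal H)$ be an irreducible norm-closed semigroup of partial isometries (not assumed self-adjoint) containing a non-zero compact operator. Then there exist $k\in\mathbb N\cup\{\infty\}$ and an irreducible group $\mathcal U$ of unitary matrices such that, after a unitary equivalence, $$\mathcal S_0^k(\mathcal U)\subseteq\mathcal S\subseteq\mathcal S_1^k(\mathcal U).$$ The size of the matrices in $\mathcal U$ is equal to the minimal non-zero rank of operators in $\mathcal S$.
   Context: An operator $A$ on $\mathcal H$ is a partial isometry if $A^*A$ and $AA^*$ are both self-adjoint projections. A semigroup of operators is a set of bounded operators closed under multiplication; it is irreducible if it has no common closed non-trivial invariant subspace. "After a unitary equivalence" means after replacing $\mathcal S$ by $W\mathcal SW^*$ for a suitable unitary $W:\mathcal H\to\bigoplus_{i=1}^k\mathbb C^r$, where $r$ is the size of the matrices in $\mathcal U$. For $k\in\mathbb N\cup\{\infty\}$ ($\infty$ meaning countably infinite), $\mathcal S_0^k$ is the semigroup of all $k\times k$ matrices having at most one non-zero entry, that entry being equal to $1$. $\mathcal S_1^k$ is the semigroup of all $k\times k$ matrices in which every row and every column has at most one non-zero entry, that entry being equal to $1$. If $\mathcal U$ is a semigroup of operators on a Hilbert space $\mathcal L$, then $\mathcal S_0^k(\mathcal U)$ and $\mathcal S_1^k(\mathcal U)$ denote the semigroups of operators on $\bigoplus_{i=1}^k\mathcal L$ whose block matrices are obtained from the matrices in $\mathcal S_0^k$ (respectively $\mathcal S_1^k$) by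 replacing the non-zero entries with (arbitrary, possibly different) elements of $\mathcal U$ and the zero entries with the zero operator on $\mathcal L$.
   Formalization: When k = 1 the lower inclusion is stated for S ∪ {0} instead of S, because S_0^1(U) contains the zero operator while S (for example S = {1} on ℂ) need not; for k ≥ 2, or when 0 is in S, the inclusion is the original one. *)

theory Defs
  imports
    "HOL-Analysis.Analysis"
    "Jordan_Normal_Form.VS_Connect"
    "Jordan_Normal_Form.Schur_Decomposition"
begin

section \<open>Complex Hilbert spaces\<close>

text \<open>
  A complex inner product space, with the inner product linear in its first argument.  Norm and
  topology are those of the underlying real inner product space, so that the operator norm and the
  norm topology on bounded operators are the library ones on type \<open>'a \<Rightarrow>\<^sub>L 'a\<close>.
  A complex Hilbert space is a type of sort \<open>{complex_inner, complete_space}\<close>.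
\<close>

class complex_inner = real_inner +
  fixes scaleC :: "complex \<Rightarrow> 'a \<Rightarrow> 'a"
    and cinner :: "'a \<Rightarrow> 'a \<Rightarrow> complex"
  assumes scaleC_add_right: "scaleC c (x + y) = scaleC c x + scaleC c y"
    and scaleC_add_left: "scaleC (c + d) x = scaleC c x + scaleC d x"
    and scaleC_scaleC: "scaleC c (scaleC d x) = scaleC (c * d) x"
    and scaleC_of_real: "scaleC (complex_of_real s) x = scaleR s x"
    and cinner_commute: "cinner x y = cnj (cinner y x)"
    and cinner_add_left: "cinner (x + y) z = cinner x z + cinner y z"
    and cinner_scaleC_left: "cinner (scaleC c x) y = c * cinner x y"
    and Re_cinner: "Re (cinner x y) = inner x y"

global_interpretation cvec: vector_space "scaleC :: complex \<Rightarrow> 'a \<Rightarrow> 'a::complex_inner"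
  defines csubspace = cvec.subspace
    and cspan = cvec.span
    and cdim = cvec.dim
proof unfold_locales
  show "scaleC 1 x = x" for x :: 'a
    using scaleC_of_real[of 1 x] by simp
qed (simp_all add: scaleC_add_right scaleC_add_left scaleC_scaleC)

section \<open>Bounded operators\<close>

text \<open>The bounded operators on a complex Hilbert space are the complex-linear elements of
  \<open>'a \<Rightarrow>\<^sub>L 'a\<close>.\<close>

definition bounded_ops :: "('a::complex_inner \<Rightarrow>\<^sub>L 'a) set" where
  "bounded_ops = {A. \<forall>c x. blinfun_apply A (scaleC c x) = scaleC c (blinfun_apply A x)}"

definition cadjoint :: "('a::complex_inner \<Rightarrow>\<^sub>L 'a) \<Rightarrow> ('a \<Rightarrow>\<^sub>L 'a)" where
  "cadjoint A = (THE B. \<forall>x y. cinner (blinfun_apply A x) y = cinner x (blinfun_apply B y))"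

definition selfadjoint_projection :: "('a::complex_inner \<Rightarrow>\<^sub>L 'a) \<Rightarrow> bool" where
  "selfadjoint_projection P \<longleftrightarrow> P \<in> bounded_ops \<and> P o\<^sub>L P = P \<and> cadjoint P = P"

definition partial_isometry :: "('a::complex_inner \<Rightarrow>\<^sub>L 'a) \<Rightarrow> bool" where
  "partial_isometry A \<longleftrightarrow> A \<in> bounded_ops \<and>
     selfadjoint_projection (cadjoint A o\<^sub>L A) \<and> selfadjoint_projection (A o\<^sub>L cadjoint A)"

definition operator_semigroup :: "('a::complex_inner \<Rightarrow>\<^sub>L 'a) set \<Rightarrow> bool" where
  "operator_semigroup S \<longleftrightarrow> S \<subseteq> bounded_ops \<and> (\<forall>A\<in>S. \<forall>B\<in>S. A o\<^sub>L B \<in> S)"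

definition irreducible_ops :: "('a::complex_inner \<Rightarrow>\<^sub>L 'a) set \<Rightarrow> bool" where
  "irreducible_ops S \<longleftrightarrow>
     \<not> (\<exists>M. csubspace M \<and> closed M \<and> M \<noteq> {0} \<and> M \<noteq> UNIV \<and> (\<forall>A\<in>S. blinfun_apply A ` M \<subseteq> M))"

definition compact_operator :: "('a::complex_inner \<Rightarrow>\<^sub>L 'a) \<Rightarrow> bool" where
  "compact_operator A \<longleftrightarrow> A \<in> bounded_ops \<and> compact (closure (blinfun_apply A ` cball 0 1))"

text \<open>The dimension of an infinite-dimensional subspace need not be meaningful under
  \<^const>\<open>cdim\<close>, hence the case distinction.\<close>

definition operator_rank :: "('a::complex_inner \<Rightarrow>\<^sub>L 'a) \<Rightarrow> enat" where
  "operator_rank A =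
     (if \<exists>B. finite B \<and> range (blinfun_apply A) \<subseteq> cspan B
      then enat (cdim (range (blinfun_apply A))) else \<infinity>)"

section \<open>Groups of unitary matrices\<close>

definition unitary_matrix :: "nat \<Rightarrow> complex mat \<Rightarrow> bool" where
  "unitary_matrix r A \<longleftrightarrow>
     A \<in> carrier_mat r r \<and> mat_adjoint A * A = 1\<^sub>m r \<and> A * mat_adjoint A = 1\<^sub>m r"

text \<open>Inverses in such a group are adjoints.\<close>

definition unitary_matrix_group :: "nat \<Rightarrow> complex mat set \<Rightarrow> bool" where
  "unitary_matrix_group r U \<longleftrightarrow>
     (\<forall>A\<in>U. unitary_matrix r A) \<and> 1\<^sub>m r \<in> U \<and>
     (\<forall>A\<in>U. \<forall>B\<in>U. A * B \<in> U) \<and> (\<forall>A\<in>U. mat_adjoint A \<in> U)"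

text \<open>All subspaces of \<open>\<complex>\<^sup>r\<close> are closed, so closedness is not mentioned.\<close>

definition irreducible_matrices :: "nat \<Rightarrow> complex mat set \<Rightarrow> bool" where
  "irreducible_matrices r U \<longleftrightarrow>
     \<not> (\<exists>M. VectorSpace.subspace class_ring M (module_vec TYPE(complex) r) \<and>
          M \<noteq> {0\<^sub>v r} \<and> M \<noteq> carrier_vec r \<and> (\<forall>A\<in>U. \<forall>v\<in>M. A *\<^sub>v v \<in> M))"

section \<open>The Hilbert space direct sum of \<open>k\<close> copies of \<open>\<complex>\<^sup>r\<close>\<close>

text \<open>
  Summands are indexed by the \<open>i :: nat\<close> with \<open>enat i < k\<close>, where \<open>k = \<infinity>\<close> is allowed;
  elements are padded with zero vectors at the remaining indices.
\<close>

definition dsum :: "enat \<Rightarrow> nat \<Rightarrow> (nat \<Rightarrow> complex Matrix.vec) set" where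
  "dsum k r = {x. (\<forall>i. x i \<in> carrier_vec r) \<and> (\<forall>i. \<not> enat i < k \<longrightarrow> x i = 0\<^sub>v r) \<and>
                  (\<lambda>i. Re (x i \<bullet>c x i)) summable_on UNIV}"

definition dsum_inner :: "(nat \<Rightarrow> complex Matrix.vec) \<Rightarrow> (nat \<Rightarrow> complex Matrix.vec) \<Rightarrow> complex" where
  "dsum_inner x y = (\<Sum>\<^sub>\<infinity>i. x i \<bullet>c y i)"

definition dsum_norm :: "(nat \<Rightarrow> complex Matrix.vec) \<Rightarrow> real" where
  "dsum_norm x = sqrt (Re (dsum_inner x x))"

text \<open>Operators on the direct sum are functions on its carrier; \<open>\<rightarrow>\<^sub>E\<close> fixes their (irrelevant)
  values elsewhere, so that equality of operators is equality of functions.\<close>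

definition dsum_ops ::
    "enat \<Rightarrow> nat \<Rightarrow> ((nat \<Rightarrow> complex Matrix.vec) \<Rightarrow> (nat \<Rightarrow> complex Matrix.vec)) set" where
  "dsum_ops k r = {T \<in> dsum k r \<rightarrow>\<^sub>E dsum k r.
     (\<forall>x\<in>dsum k r. \<forall>y\<in>dsum k r. T (\<lambda>i. x i + y i) = (\<lambda>i. T x i + T y i)) \<and>
     (\<forall>c. \<forall>x\<in>dsum k r. T (\<lambda>i. c \<cdot>\<^sub>v x i) = (\<lambda>i. c \<cdot>\<^sub>v T x i)) \<and>
     (\<exists>C. \<forall>x\<in>dsum k r. dsum_norm (T x) \<le> C * dsum_norm x)}"

definition unitary_onto_dsum ::
    "enat \<Rightarrow> nat \<Rightarrow> ('a::complex_inner \<Rightarrow> nat \<Rightarrow> complex Matrix.vec) \<Rightarrow> bool" where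
  "unitary_onto_dsum k r W \<longleftrightarrow>
     bij_betw W UNIV (dsum k r) \<and>
     (\<forall>x y. W (x + y) = (\<lambda>i. W x i + W y i)) \<and>
     (\<forall>c x. W (scaleC c x) = (\<lambda>i. c \<cdot>\<^sub>v W x i)) \<and>
     (\<forall>x y. dsum_inner (W x) (W y) = cinner x y)"

text \<open>\<open>W A W\<^sup>*\<close> for unitary \<open>W\<close>, where \<open>W\<^sup>*\<close> is the inverse of \<open>W\<close>.\<close>

definition unitary_conj ::
    "enat \<Rightarrow> nat \<Rightarrow> ('a::complex_inner \<Rightarrow> nat \<Rightarrow> complex Matrix.vec) \<Rightarrow> ('a \<Rightarrow>\<^sub>L 'a)
       \<Rightarrow> ((nat \<Rightarrow> complex Matrix.vec) \<Rightarrow> (nat \<Rightarrow> complex Matrix.vec))" where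
  "unitary_conj k r W A = (\<lambda>x\<in>dsum k r. W (blinfun_apply A (inv_into UNIV W x)))"

text \<open>The \<open>(i, j)\<close> block of an operator on the direct sum, in the standard basis of \<open>\<complex>\<^sup>r\<close>.\<close>

definition block :: "nat \<Rightarrow> ((nat \<Rightarrow> complex Matrix.vec) \<Rightarrow> (nat \<Rightarrow> complex Matrix.vec))
    \<Rightarrow> nat \<Rightarrow> nat \<Rightarrow> complex mat" where
  "block r T i j =
     Matrix.mat r r (\<lambda>(a, b). vec_index (T (\<lambda>l. if l = j then unit_vec r b else 0\<^sub>v r) i) a)"

section \<open>The semigroups \<open>S\<^sub>0\<^sup>k\<close> and \<open>S\<^sub>1\<^sup>k\<close>\<close>

text \<open>A \<open>k \<times> k\<close> matrix, \<open>k \<le> \<infinity>\<close>, is a function on \<open>nat \<times> nat\<close> that vanishes outside the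
  index range.\<close>

definition zero_one_matrices :: "enat \<Rightarrow> (nat \<Rightarrow> nat \<Rightarrow> complex) set" where
  "zero_one_matrices k =
     {P. (\<forall>i j. P i j = 0 \<or> P i j = 1) \<and> (\<forall>i j. P i j \<noteq> 0 \<longrightarrow> enat i < k \<and> enat j < k)}"

definition S0 :: "enat \<Rightarrow> (nat \<Rightarrow> nat \<Rightarrow> complex) set" where
  "S0 k = {P \<in> zero_one_matrices k.
     \<forall>i j i' j'. P i j \<noteq> 0 \<longrightarrow> P i' j' \<noteq> 0 \<longrightarrow> i = i' \<and> j = j'}"

definition S1 :: "enat \<Rightarrow> (nat \<Rightarrow> nat \<Rightarrow> complex) set" where
  "S1 k = {P \<in> zero_one_matrices k.
     (\<forall>i j j'. P i j \<noteq> 0 \<longrightarrow> P i j' \<noteq> 0 \<longrightarrow> j = j') \<and>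
     (\<forall>i i' j. P i j \<noteq> 0 \<longrightarrow> P i' j \<noteq> 0 \<longrightarrow> i = i')}"

text \<open>The operators whose block matrices arise from the matrices in \<open>F\<close> by replacing non-zero
  entries by elements of \<open>U\<close> and zero entries by the zero matrix.\<close>

definition block_ops :: "enat \<Rightarrow> nat \<Rightarrow> (nat \<Rightarrow> nat \<Rightarrow> complex) set \<Rightarrow> complex mat set
    \<Rightarrow> ((nat \<Rightarrow> complex Matrix.vec) \<Rightarrow> (nat \<Rightarrow> complex Matrix.vec)) set" where
  "block_ops k r F U = {T \<in> dsum_ops k r.
     \<exists>P\<in>F. \<forall>i j. enat i < k \<longrightarrow> enat j < k \<longrightarrow>
       (if P i j = 0 then block r T i j = 0\<^sub>m r r else block r T i j \<in> U)}"

text \<open>The zero matrix belongs to \<open>S0 k\<close>, hence the zero operator to \<open>S0_ops k r U\<close>.  An irreducible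
  group of unitary \<open>r \<times> r\<close> matrices that is closed in norm, viewed as a semigroup \<open>S\<close> on \<open>\<complex>\<^sup>r\<close>, has
  \<open>k = 1\<close> but does not contain zero; so for \<open>k = 1\<close> the lower bound \<open>S0_ops k r U\<close> can only be
  expected for \<open>S \<union> {0}\<close>.  For \<open>k \<ge> 2\<close> zero is a product of two elements of \<open>S0_ops k r U\<close>
  that are different from zero.\<close>

abbreviation S0_ops :: "enat \<Rightarrow> nat \<Rightarrow> complex mat set
    \<Rightarrow> ((nat \<Rightarrow> complex Matrix.vec) \<Rightarrow> (nat \<Rightarrow> complex Matrix.vec)) set" where
  "S0_ops k r U \<equiv> block_ops k r (S0 k) U"

abbreviation S1_ops :: "enat \<Rightarrow> nat \<Rightarrow> complex mat set
    \<Rightarrow> ((nat \<Rightarrow> complex Matrix.vec) \<Rightarrow> (nat \<Rightarrow> complex Matrix.vec)) set" where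
  "S1_ops k r U \<equiv> block_ops k r (S1 k) U"

section \<open>Existence and uniqueness of adjoints\<close>

lemma riesz_representation_real:
  fixes f :: "'a::{real_inner, complete_space} \<Rightarrow> real"
  assumes f: "bounded_linear f"
  shows "\<exists>v. \<forall>x. f x = inner v x"
proof -
  interpret f: bounded_linear f by (rule f)
  define J where "J x = inner x x - 2 * f x" for x
  obtain K where K: "\<And>x. norm (f x) \<le> norm x * K"
    using f.bounded by blast
  have J_ge: "J x \<ge> - K\<^sup>2" for x
  proof -
    have "f x \<le> norm x * K" using K[of x] by simp
    moreover have "0 \<le> (norm x - K)\<^sup>2" by simp
    ultimately show ?thesis
      unfolding J_def by (simp add: power2_norm_eq_inner[symmetric] power2_eq_square algebra_simps)
  qed
  define m where "m = Inf (range J)"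
  have bdd: "bdd_below (range J)" using J_ge by (auto intro!: bdd_belowI)
  have m_le: "m \<le> J x" for x unfolding m_def using bdd by (auto intro: cInf_lower)
  have "\<exists>x. J x < m + 1 / real (Suc n)" for n
  proof -
    have "\<exists>y\<in>range J. y < m + 1 / real (Suc n)"
      by (rule cInf_lessD) (auto simp: m_def[symmetric])
    then show ?thesis by auto
  qed
  then obtain X where X: "\<And>n. J (X n) < m + 1 / real (Suc n)" by metis
  have par: "inner (x - y) (x - y) = 2 * J x + 2 * J y - 4 * J ((1/2) *\<^sub>R (x + y))" for x y
    unfolding J_def
    by (simp add: f.scaleR f.add inner_add_left inner_add_right inner_diff_left inner_diff_right
        inner_commute algebra_simps)
  have dist2: "(dist x y)\<^sup>2 \<le> 2 * (J x - m) + 2 * (J y - m)" for x y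
    using par[of x y] m_le[of "(1/2) *\<^sub>R (x + y)"]
    by (simp add: dist_norm power2_norm_eq_inner)
  have "Cauchy X"
  proof (rule metric_CauchyI)
    fix e :: real assume e: "0 < e"
    obtain N where N: "4 / e\<^sup>2 < real N" using reals_Archimedean2 by blast
    have "dist (X a) (X b) < e" if "a \<ge> N" "b \<ge> N" for a b
    proof -
      have N0: "real N > 0" using N e by (smt (verit) divide_pos_pos zero_less_power)
      have "1 / real (Suc a) \<le> 1 / real N" "1 / real (Suc b) \<le> 1 / real N"
        using that N0 by (auto intro!: divide_left_mono)
      then have "(dist (X a) (X b))\<^sup>2 < 4 / real N"
        using dist2[of "X a" "X b"] X[of a] X[of b] by simp
      also have "\<dots> < e\<^sup>2" using N N0 e by (simp add: field_simps)
      finally show ?thesis using e by (simp add: power2_less_imp_less)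
    qed
    then show "\<exists>M. \<forall>m\<ge>M. \<forall>n\<ge>M. dist (X m) (X n) < e" by blast
  qed
  then obtain v where v: "X \<longlonglongrightarrow> v" using Cauchy_convergent convergent_def by blast
  have "(\<lambda>n. J (X n)) \<longlonglongrightarrow> J v"
    unfolding J_def by (intro tendsto_intros v f.tendsto)
  moreover have "(\<lambda>n. m + 1 / real (Suc n)) \<longlonglongrightarrow> m + 0"
    by (intro tendsto_intros LIMSEQ_Suc[OF lim_1_over_n])
  ultimately have Jv: "J v \<le> m"
    using X by (intro LIMSEQ_le[where X="\<lambda>n. J (X n)"]) (auto intro: less_imp_le)
  have "f x = inner v x" for x
  proof -
    define d where "d = inner v x - f x"
    define n where "n = inner x x"
    define t where "t = - d / (n + 1)"
    have n: "n \<ge> 0" by (simp add: n_def)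
    have "J v \<le> J (v + t *\<^sub>R x)" using Jv m_le order_trans by blast
    then have "0 \<le> 2 * t * d + t\<^sup>2 * n"
      unfolding J_def d_def n_def
      by (simp add: f.add f.scaleR inner_add_left inner_add_right inner_commute power2_eq_square
          algebra_simps)
    then have "0 \<le> (2 * t * d + t\<^sup>2 * n) * (n + 1)\<^sup>2" by simp
    also have "\<dots> = 2 * (t * (n + 1)) * d * (n + 1) + (t * (n + 1))\<^sup>2 * n"
      by (simp add: power2_eq_square algebra_simps)
    also have "t * (n + 1) = - d" using n by (simp add: t_def)
    finally have "0 \<le> - (d\<^sup>2 * (n + 2))" by (simp add: power2_eq_square algebra_simps)
    then have "d\<^sup>2 * (n + 2) \<le> 0" by simp
    then have "d = 0" using n
      by (smt (verit) mult_pos_pos zero_less_power2)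
    then show ?thesis by (simp add: d_def)
  qed
  then show ?thesis by blast
qed

lemma cinner_eqI:
  assumes "\<And>x. cinner x y = cinner x z"
  shows "y = (z :: 'a::complex_inner)"
proof -
  have "inner (y - z) y = inner (y - z) z" using assms by (metis Re_cinner)
  then show ?thesis by (metis inner_diff_right inner_eq_zero_iff right_minus_eq)
qed

lemma ex1_cadjoint:
  fixes A :: "'a::{complex_inner, complete_space} \<Rightarrow>\<^sub>L 'a"
  assumes A: "A \<in> bounded_ops"
  shows "\<exists>!B. \<forall>x y. cinner (blinfun_apply A x) y = cinner x (blinfun_apply B y)"
proof (rule ex_ex1I)
  have "\<exists>v. \<forall>x. inner (blinfun_apply A x) y = inner v x" for y
    by (rule riesz_representation_real)
      (intro bounded_linear_inner_left_comp blinfun.bounded_linear_right)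
  then obtain g where g: "\<And>y x. inner (blinfun_apply A x) y = inner (g y) x" by metis
  have gadd: "g (x + y) = g x + g y" for x y
  proof -
    have "inner (g (x + y) - (g x + g y)) z = 0" for z
      by (simp add: inner_diff_left inner_add_left inner_add_right g[symmetric])
    then show ?thesis by (metis inner_eq_zero_iff right_minus_eq)
  qed
  have gscale: "g (s *\<^sub>R x) = s *\<^sub>R g x" for s x
  proof -
    have "inner (g (s *\<^sub>R x) - s *\<^sub>R g x) z = 0" for z
      by (simp add: inner_diff_left g[symmetric])
    then show ?thesis by (metis inner_eq_zero_iff right_minus_eq)
  qed
  have gbound: "norm (g y) \<le> norm y * norm A" for y
  proof (cases "g y = 0")
    case False
    have "norm (g y) * norm (g y) = inner (blinfun_apply A (g y)) y"
      by (simp add: g power2_norm_eq_inner[symmetric] power2_eq_square)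
    also have "\<dots> \<le> norm (blinfun_apply A (g y)) * norm y" by (rule norm_cauchy_schwarz)
    also have "\<dots> \<le> (norm A * norm (g y)) * norm y"
      by (intro mult_right_mono norm_blinfun) simp
    finally have "norm (g y) * norm (g y) \<le> norm (g y) * (norm y * norm A)"
      by (simp add: mult_ac)
    then show ?thesis using False by simp
  qed simp
  have "bounded_linear g"
    by (rule bounded_linear_intro[OF gadd gscale gbound])
  then have B: "blinfun_apply (Blinfun g) = g" by (rule bounded_linear_Blinfun_apply)
  have Im: "Im (cinner x y) = - inner (scaleC \<i> x) y" for x y :: 'a
    by (simp add: Re_cinner[symmetric] cinner_scaleC_left)
  have "cinner (blinfun_apply A x) y = cinner x (g y)" for x y
  proof (rule complex_eqI)
    show "Re (cinner (blinfun_apply A x) y) = Re (cinner x (g y))"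
      unfolding Re_cinner using g[of x y] by (simp only: inner_commute)
    show "Im (cinner (blinfun_apply A x) y) = Im (cinner x (g y))"
      using A g[of "scaleC \<i> x" y] inner_commute[of "g y"]
      by (simp add: Im bounded_ops_def)
  qed
  then show "\<exists>B. \<forall>x y. cinner (blinfun_apply A x) y = cinner x (blinfun_apply B y)"
    by (metis B)
next
  fix B C
  assume "\<forall>x y. cinner (blinfun_apply A x) y = cinner x (blinfun_apply B y)"
    and "\<forall>x y. cinner (blinfun_apply A x) y = cinner x (blinfun_apply C y)"
  then show "B = C" by (intro blinfun_eqI cinner_eqI) metis
qed

lemma cadjoint_works:
  fixes A :: "'a::{complex_inner, complete_space} \<Rightarrow>\<^sub>L 'a"
  assumes "A \<in> bounded_ops"
  shows "cinner (blinfun_apply A x) y = cinner x (blinfun_apply (cadjoint A) y)"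
  using theI'[OF ex1_cadjoint[OF assms]] unfolding cadjoint_def by blast

end

theory Submission
  imports Defs
begin

text \<open>
  Let \<open>r\<close> be the least non-zero rank in \<open>S\<close>.  It is finite because a compact partial isometry has
  finite rank.  The proof extracts matrix units from the operators of rank \<open>r\<close>.

  \<^bold>\<open>A projection in \<open>S\<close>.\<close>  If \<open>A\<close> has rank \<open>r\<close>, then \<open>T A\<close> and \<open>A T\<close> are zero or again of rank \<open>r\<close>
  for all \<open>T \<in> S\<close>.  Therefore \<open>T\<close> is isometric on the range of \<open>A\<close> whenever \<open>T A \<noteq> 0\<close>, and \<open>A T\<close> has
  the same range as \<open>A\<close> whenever \<open>A T \<noteq> 0\<close>.  Hence if \<open>A A \<noteq> 0\<close>, then \<open>A\<close> is a unitary on its range, extended by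
  zero (\<open>minimal_square_normal\<close>).  The powers of such an operator accumulate because its range is
  finite-dimensional, and as \<open>S\<close> is norm closed it contains \<open>A\<^sup>*\<close> and the projection \<open>A\<^sup>* A\<close>
  (\<open>cadjoint_in_closed_semigroup\<close>).  Irreducibility supplies an \<open>A\<close> with \<open>A A \<noteq> 0\<close>.  Fix one of
  the resulting projections \<open>P \<in> S\<close> of rank \<open>r\<close>.  The non-zero elements of \<open>P S P\<close> act as unitaries
  on the range of \<open>P\<close>, and they form a group, the corner.

  \<^bold>\<open>Matrix units.\<close>  The non-zero elements of \<open>S P\<close>, here called columns, are partial isometries with
  initial projection \<open>P\<close>.  Their adjoints belong to \<open>S\<close> (\<open>columns_cadjoint_S\<close>): by irreducibility a
  column has a left inverse in \<open>P S\<close>, and idempotent partial isometries are self-adjoint, which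
  identifies the left inverse as the adjoint.  Consequently \<open>D\<^sup>* E\<close> lies in the corner or vanishes for any
  two columns, so that their ranges are equal or orthogonal (\<open>columns_range_cases\<close>).  By irreducibility the ranges
  span a dense subspace and by separability there are countably many.  Choose one column
  \<open>D\<^sub>i\<close> for each range, and an orthonormal basis \<open>e\<close> of the range of \<open>P\<close>.  The vectors \<open>D\<^sub>i e\<^sub>b\<close> form an
  orthonormal basis of the whole space, and \<open>W\<close> takes coordinates with respect to it.

  \<^bold>\<open>The two inclusions.\<close>  The \<open>(i, j)\<close> block of \<open>W A W\<^sup>*\<close> is the matrix of \<open>D\<^sub>i\<^sup>* A D\<^sub>j\<close>, which for \<open>A \<in> S\<close> is zero or
  an element of the corner.  A column of blocks has at most one non-zero entry because \<open>A D\<^sub>j\<close> is zero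
  or a column, and the columns have equal or orthogonal ranges.  A row has at most one because
  \<open>D\<^sub>i\<^sup>* A\<close> is a contraction (\<open>row_entry_unique\<close>).  Conversely, the operator with
  the single non-zero block \<open>X\<close> at \<open>(i, j)\<close> is \<open>D\<^sub>i X D\<^sub>j\<^sup>* \<in> S\<close>.
\<close>

section \<open>Complex inner products and adjoints\<close>

lemma cinner_add_right: "cinner x (y + z) = cinner x y + cinner x (z :: 'a::complex_inner)"
  by (metis cinner_add_left cinner_commute complex_cnj_add)

lemma cinner_scaleC_right: "cinner x (scaleC c y) = cnj c * cinner x (y :: 'a::complex_inner)"
  by (metis cinner_scaleC_left cinner_commute complex_cnj_mult)

lemma cinner_zero [simp]:
  "cinner 0 x = 0" "cinner x 0 = 0" for x :: "'a::complex_inner"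
  using cinner_add_left[of 0 0 x] cinner_add_right[of x 0 0] by auto

lemma scaleC_zero [simp]:
  "scaleC c 0 = 0" "scaleC 0 x = 0" for x :: "'a::complex_inner"
  by auto

lemma scaleC_minus_one: "scaleC (- 1) x = - x" for x :: "'a::complex_inner"
  by auto

lemma cinner_minus_left: "cinner (- x) y = - cinner x (y :: 'a::complex_inner)"
  using cinner_scaleC_left[of "-1" x y] by (simp add: scaleC_minus_one)

lemma cinner_minus_right: "cinner x (- y) = - cinner x (y :: 'a::complex_inner)"
  using cinner_scaleC_right[of x "-1" y] by (simp add: scaleC_minus_one)

lemma cinner_diff_left: "cinner (x - y) z = cinner x z - cinner y (z :: 'a::complex_inner)"
  using cinner_add_left[of x "- y" z] by (simp add: cinner_minus_left)

lemma cinner_diff_right: "cinner x (y - z) = cinner x y - cinner x (z :: 'a::complex_inner)"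
  using cinner_add_right[of x y "- z"] by (simp add: cinner_minus_right)

lemma cinner_sum_left: "cinner (\<Sum>i\<in>I. f i) y = (\<Sum>i\<in>I. cinner (f i) (y :: 'a::complex_inner))"
  by (induction I rule: infinite_finite_induct) (auto simp: cinner_add_left)

lemma cinner_sum_right: "cinner y (\<Sum>i\<in>I. f i) = (\<Sum>i\<in>I. cinner y (f i :: 'a::complex_inner))"
  by (induction I rule: infinite_finite_induct) (auto simp: cinner_add_right)

lemmas cinner_linear_simps =
  cinner_add_left cinner_add_right cinner_diff_left cinner_diff_right cinner_minus_left
  cinner_minus_right cinner_scaleC_left cinner_scaleC_right cinner_sum_left cinner_sum_right

lemma cinner_self: "cinner x x = complex_of_real ((norm x)\<^sup>2)" for x :: "'a::complex_inner"
proof (rule complex_eqI)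
  show "Im (cinner x x) = Im (complex_of_real ((norm x)\<^sup>2))"
    using arg_cong[OF cinner_commute[of x x], of Im] by simp
qed (simp add: Re_cinner power2_norm_eq_inner)

lemma cinner_self_eq_0 [simp]: "cinner x x = 0 \<longleftrightarrow> x = 0" for x :: "'a::complex_inner"
  by (simp add: cinner_self)

lemma cinner_eq_0_commute: "cinner x y = 0 \<longleftrightarrow> cinner y x = 0" for x y :: "'a::complex_inner"
  using cinner_commute[of x y] by simp

lemma norm_scaleC: "norm (scaleC c x) = cmod c * norm x" for x :: "'a::complex_inner"
proof -
  have "cinner (scaleC c x) (scaleC c x) = (c * cnj c) * cinner x x"
    by (simp add: cinner_scaleC_left cinner_scaleC_right)
  also have "\<dots> = complex_of_real ((cmod c * norm x)\<^sup>2)"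
    by (simp only: complex_norm_square[symmetric] cinner_self power_mult_distrib of_real_mult)
  finally have "(norm (scaleC c x))\<^sup>2 = (cmod c * norm x)\<^sup>2"
    by (simp add: cinner_self del: of_real_power)
  then show ?thesis by simp
qed

lemma pythagoras: "(norm (x + y))\<^sup>2 = (norm x)\<^sup>2 + (norm y)\<^sup>2"
  if "cinner x y = 0" for x y :: "'a::complex_inner"
proof -
  have "inner x y = 0" using that Re_cinner[of x y] by simp
  then show ?thesis
    by (simp add: power2_norm_eq_inner inner_add_left inner_add_right inner_commute)
qed

text \<open>The imaginary part of the inner product is itself a real inner product with a rotated
  vector, which makes the library's continuity rules for \<^const>\<open>inner\<close> available.\<close>

lemma cinner_eq_Complex: "cinner x y = Complex (inner x y) (inner x (scaleC \<i> y))"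
  for x y :: "'a::complex_inner"
  by (rule complex_eqI) (simp_all add: Re_cinner[symmetric] cinner_scaleC_right)

lemma tendsto_cinner_left:
  "(f \<longlongrightarrow> x) F \<Longrightarrow> ((\<lambda>n. cinner (f n) y) \<longlongrightarrow> cinner x (y :: 'a::complex_inner)) F"
  unfolding cinner_eq_Complex by (intro tendsto_Complex tendsto_inner tendsto_const)

lemma continuous_on_cinner_left: "continuous_on T (\<lambda>x. cinner x (y :: 'a::complex_inner))"
  by (simp add: continuous_on_def tendsto_cinner_left)

lemma cmod_cinner_le: "cmod (cinner x y) \<le> norm x * norm y" for x y :: "'a::complex_inner"
proof (cases "cinner x y = 0")
  case False
  define c where "c = cnj (sgn (cinner x y))"
  have "complex_of_real (cmod (cinner x y)) = cinner (scaleC c x) y"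
    using False by (simp add: c_def cinner_scaleC_left sgn_eq field_simps complex_norm_square[symmetric]
        power2_eq_square)
  then have "cmod (cinner x y) = inner (scaleC c x) y"
    by (metis Re_complex_of_real Re_cinner)
  also have "\<dots> \<le> norm (scaleC c x) * norm y" by (rule norm_cauchy_schwarz)
  also have "\<dots> = norm x * norm y" using False by (simp add: norm_scaleC c_def norm_sgn)
  finally show ?thesis .
qed simp

lemma bounded_opsD: "A \<in> bounded_ops \<Longrightarrow> blinfun_apply A (scaleC c x) = scaleC c (blinfun_apply A x)"
  by (simp add: bounded_ops_def)

lemma bounded_ops_compose [intro]:
  "A \<in> bounded_ops \<Longrightarrow> B \<in> bounded_ops \<Longrightarrow> A o\<^sub>L B \<in> bounded_ops"
  by (simp add: bounded_ops_def)

lemma blinfun_compose_assoc: "(A o\<^sub>L B) o\<^sub>L C = A o\<^sub>L (B o\<^sub>L C)"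
  by (rule blinfun_eqI) simp

lemma blinfun_compose_diff_right: "A o\<^sub>L (B - C) = (A o\<^sub>L B) - (A o\<^sub>L C)"
  by (rule bounded_bilinear.diff_right[OF bounded_bilinear_blinfun_compose])

lemma blinfun_compose_nonzero: "blinfun_apply A (blinfun_apply B x) \<noteq> 0 \<Longrightarrow> A o\<^sub>L B \<noteq> 0"
  by (metis blinfun_apply_blinfun_compose zero_blinfun.rep_eq)

lemma cadjoint_unique:
  fixes A :: "'a::{complex_inner, complete_space} \<Rightarrow>\<^sub>L 'a"
  assumes "A \<in> bounded_ops" and "\<And>x y. cinner (A x) y = cinner x (blinfun_apply B y)"
  shows "cadjoint A = B"
  by (intro blinfun_eqI cinner_eqI) (metis assms cadjoint_works)

lemma cadjoint_works_right:
  fixes A :: "'a::{complex_inner, complete_space} \<Rightarrow>\<^sub>L 'a"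
  assumes "A \<in> bounded_ops"
  shows "cinner x (A y) = cinner (cadjoint A x) y"
  by (metis assms cadjoint_works cinner_commute)

lemma cadjoint_bounded_ops [intro]:
  fixes A :: "'a::{complex_inner, complete_space} \<Rightarrow>\<^sub>L 'a"
  assumes "A \<in> bounded_ops"
  shows "cadjoint A \<in> bounded_ops"
  unfolding bounded_ops_def
proof (clarify, rule cinner_eqI)
  fix c x y
  show "cinner y (cadjoint A (scaleC c x)) = cinner y (scaleC c (cadjoint A x))"
    by (simp add: cadjoint_works[OF assms, symmetric] cinner_scaleC_right)
qed

lemma cadjoint_cadjoint [simp]:
  fixes A :: "'a::{complex_inner, complete_space} \<Rightarrow>\<^sub>L 'a"
  assumes "A \<in> bounded_ops"
  shows "cadjoint (cadjoint A) = A"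
  by (rule cadjoint_unique) (use assms in \<open>auto simp: cadjoint_works_right\<close>)

lemma cadjoint_compose:
  fixes A B :: "'a::{complex_inner, complete_space} \<Rightarrow>\<^sub>L 'a"
  assumes "A \<in> bounded_ops" "B \<in> bounded_ops"
  shows "cadjoint (A o\<^sub>L B) = cadjoint B o\<^sub>L cadjoint A"
  by (rule cadjoint_unique) (use assms in \<open>auto simp: cadjoint_works\<close>)

section \<open>Partial isometries\<close>

lemma partial_isometry_bounded_ops: "partial_isometry A \<Longrightarrow> A \<in> bounded_ops"
  by (simp add: partial_isometry_def)

text \<open>The projection \<open>A\<^sup>*A\<close> maps onto the initial space, and \<open>A\<close> loses exactly the component
  orthogonal to it.\<close>

lemma partial_isometry_norm:
  fixes A :: "'a::{complex_inner, complete_space} \<Rightarrow>\<^sub>L 'a"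
  assumes A: "partial_isometry A"
  shows "(norm (x - cadjoint A (A x)))\<^sup>2 = (norm x)\<^sup>2 - (norm (A x))\<^sup>2"
proof -
  let ?Q = "cadjoint A o\<^sub>L A"
  have Ab: "A \<in> bounded_ops" and Qb: "?Q \<in> bounded_ops"
    and QQ: "?Q o\<^sub>L ?Q = ?Q" and sa: "cadjoint ?Q = ?Q"
    using A by (auto simp: partial_isometry_def selfadjoint_projection_def)
  have 1: "cinner x (?Q x) = cinner (A x) (A x)"
    using Ab by (simp add: cadjoint_works)
  have 2: "cinner (?Q x) (?Q x) = cinner (A x) (A x)"
    by (metis 1 QQ sa Qb cadjoint_works blinfun_apply_blinfun_compose)
  have 3: "cinner (?Q x) x = cinner (A x) (A x)"
    by (metis 1 cinner_commute)
  have "cinner (x - ?Q x) (x - ?Q x) = cinner x x - cinner (A x) (A x)"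
    using 1 2 3 by (simp add: cinner_linear_simps)
  then have "complex_of_real ((norm (x - ?Q x))\<^sup>2) = of_real ((norm x)\<^sup>2 - (norm (A x))\<^sup>2)"
    by (simp add: cinner_self)
  then show ?thesis by (simp only: of_real_eq_iff blinfun_apply_blinfun_compose)
qed

lemma partial_isometry_contraction:
  fixes A :: "'a::{complex_inner, complete_space} \<Rightarrow>\<^sub>L 'a"
  assumes "partial_isometry A"
  shows "norm (A x) \<le> norm x"
  using partial_isometry_norm[OF assms, of x]
  by (metis diff_ge_0_iff_ge norm_ge_zero power2_le_imp_le zero_le_power2)

lemma partial_isometry_isometric:
  fixes A :: "'a::{complex_inner, complete_space} \<Rightarrow>\<^sub>L 'a"
  assumes "partial_isometry A" "norm (A x) = norm x"
  shows "cadjoint A (A x) = x"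
  using partial_isometry_norm[OF assms(1), of x] assms(2) by simp

lemma partial_isometry_triple:
  fixes A :: "'a::{complex_inner, complete_space} \<Rightarrow>\<^sub>L 'a"
  assumes A: "partial_isometry A"
  shows "A o\<^sub>L (cadjoint A o\<^sub>L A) = A"
proof (rule blinfun_eqI)
  fix x
  let ?y = "x - cadjoint A (A x)"
  have "(cadjoint A o\<^sub>L A) o\<^sub>L (cadjoint A o\<^sub>L A) = cadjoint A o\<^sub>L A"
    using A by (simp add: partial_isometry_def selfadjoint_projection_def)
  then have "cadjoint A (A (cadjoint A (A x))) = cadjoint A (A x)"
    by (metis blinfun_apply_blinfun_compose)
  then have "cadjoint A (A ?y) = 0" by (simp add: blinfun.diff_right)
  then have "A ?y = 0" using partial_isometry_norm[OF A, of ?y] by simp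
  then show "(A o\<^sub>L (cadjoint A o\<^sub>L A)) x = A x" by (simp add: blinfun.diff_right)
qed

lemma partial_isometry_triple_apply:
  fixes A :: "'a::{complex_inner, complete_space} \<Rightarrow>\<^sub>L 'a"
  assumes "partial_isometry A"
  shows "A (cadjoint A (A x)) = A x"
  by (metis partial_isometry_triple[OF assms] blinfun_apply_blinfun_compose)

lemma partial_isometry_cadjoint:
  fixes A :: "'a::{complex_inner, complete_space} \<Rightarrow>\<^sub>L 'a"
  assumes "partial_isometry A"
  shows "partial_isometry (cadjoint A)"
  using assms by (auto simp: partial_isometry_def)

text \<open>An idempotent \<open>F\<close> is isometric on its range, so its range lies in the initial space.  Thus
  \<open>F\<^sup>*F F = F\<close>, while \<open>F F = F\<close> makes the same product \<open>F\<^sup>*F\<close>.\<close>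

lemma partial_isometry_idempotent:
  fixes F :: "'a::{complex_inner, complete_space} \<Rightarrow>\<^sub>L 'a"
  assumes F: "partial_isometry F" and FF: "F o\<^sub>L F = F"
  shows "cadjoint F = F"
proof -
  have FFx: "F (F x) = F x" for x by (metis FF blinfun_apply_blinfun_compose)
  have "cadjoint F (F (F x)) = F x" for x
    by (rule partial_isometry_isometric[OF F]) (simp add: FFx)
  then have "cadjoint F o\<^sub>L F = F" by (intro blinfun_eqI) (simp add: FFx)
  moreover have "cadjoint (cadjoint F o\<^sub>L F) = cadjoint F o\<^sub>L F"
    using F by (simp add: partial_isometry_def selfadjoint_projection_def)
  ultimately show ?thesis by simp
qed

section \<open>Finite-dimensional subspaces and orthonormal families\<close>

definition finite_dim :: "'a::complex_inner set \<Rightarrow> bool" where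
  "finite_dim V \<longleftrightarrow> (\<exists>B. finite B \<and> V \<subseteq> cspan B)"

lemma finite_dimI: "finite B \<Longrightarrow> V \<subseteq> cspan B \<Longrightarrow> finite_dim V"
  unfolding finite_dim_def by blast

lemma finite_dim_subset: "finite_dim W \<Longrightarrow> V \<subseteq> W \<Longrightarrow> finite_dim V"
  unfolding finite_dim_def by (meson order_trans)

lemma finite_dim_independent:
  assumes "finite_dim V" "cvec.independent C" "C \<subseteq> V"
  shows "finite C"
  using assms cvec.independent_span_bound[of _ C] unfolding finite_dim_def by (meson order_trans)

lemma csubspace_orthogonal: "csubspace {x. cinner x y = 0}"
  by (simp add: cvec.subspace_def cinner_linear_simps)

lemma cspan_orthogonal:
  assumes "\<And>x. x \<in> B \<Longrightarrow> cinner x y = 0" "x \<in> cspan B"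
  shows "cinner x y = 0"
  using cvec.span_minimal[OF _ csubspace_orthogonal[of y], of B] assms by auto

lemma finite_dim_basis:
  assumes "finite_dim V"
  shows "\<exists>C. finite C \<and> C \<subseteq> V \<and> cvec.independent C \<and> V \<subseteq> cspan C \<and> card C = cdim V"
proof -
  obtain C where C: "C \<subseteq> V" "cvec.independent C" "V \<subseteq> cspan C" "card C = cdim V"
    by (rule cvec.basis_exists)
  have "finite C" by (rule finite_dim_independent[OF assms C(2,1)])
  then show ?thesis using C by blast
qed

lemma cdim_mono:
  assumes "finite_dim W" "V \<subseteq> W"
  shows "cdim V \<le> cdim W"
proof -
  obtain C where "finite C" "W \<subseteq> cspan C" "card C = cdim W"
    using finite_dim_basis[OF assms(1)] by metis
  then show ?thesis using cvec.dim_le_card[of V C] assms(2) by auto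
qed

lemma csubspace_eqI_cdim:
  assumes "csubspace V" "finite_dim W" "V \<subseteq> W" "cdim W \<le> cdim V"
  shows "V = W"
proof (rule ccontr)
  assume "V \<noteq> W"
  then obtain w where w: "w \<in> W" "w \<notin> V" using assms(3) by auto
  have "finite_dim V" by (rule finite_dim_subset[OF assms(2,3)])
  obtain C where C: "finite C" "C \<subseteq> V" "cvec.independent C" "V \<subseteq> cspan C" "card C = cdim V"
    using finite_dim_basis[OF \<open>finite_dim V\<close>] by metis
  obtain D where D: "finite D" "W \<subseteq> cspan D" "card D = cdim W"
    using finite_dim_basis[OF assms(2)] by metis
  have "cspan C = V" using C assms(1) by (meson cvec.span_minimal subset_antisym)
  then have "cvec.independent (insert w C)" "w \<notin> C"
    using w C by (auto simp: cvec.independent_insert)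
  moreover have "insert w C \<subseteq> cspan D" using w C D assms(3) by auto
  ultimately have "card (insert w C) \<le> card D"
    using D(1) cvec.independent_span_bound by blast
  then show False using C D assms(4) \<open>w \<notin> C\<close> by simp
qed

lemma linear_bounded_ops:
  "A \<in> bounded_ops \<Longrightarrow> Vector_Spaces.linear scaleC scaleC (blinfun_apply A)"
  by unfold_locales (simp_all add: blinfun.add_right bounded_opsD)

lemma cspan_image:
  assumes "A \<in> bounded_ops"
  shows "cspan (blinfun_apply A ` X) = blinfun_apply A ` cspan X"
proof -
  interpret Vector_Spaces.linear scaleC scaleC "blinfun_apply A"
    by (rule linear_bounded_ops[OF assms])
  show ?thesis by (simp add: span_image cspan_def)
qed

lemma csubspace_image:
  assumes "A \<in> bounded_ops" "csubspace V"
  shows "csubspace (blinfun_apply A ` V)"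
  by (metis assms cspan_image cvec.span_eq_iff)

lemma csubspace_range: "A \<in> bounded_ops \<Longrightarrow> csubspace (range (blinfun_apply A))"
  by (rule csubspace_image) auto

lemma finite_dim_image:
  assumes "A \<in> bounded_ops" "finite_dim V"
  shows "finite_dim (blinfun_apply A ` V)"
proof -
  obtain B where "finite B" "V \<subseteq> cspan B" using assms(2) unfolding finite_dim_def by blast
  then have "finite (A ` B)" "A ` V \<subseteq> cspan (A ` B)"
    by (auto simp: cspan_image[OF assms(1)])
  then show ?thesis by (rule finite_dimI)
qed

lemma cdim_image_le:
  assumes "A \<in> bounded_ops" "finite_dim V"
  shows "cdim (blinfun_apply A ` V) \<le> cdim V"
proof -
  obtain C where C: "finite C" "V \<subseteq> cspan C" "card C = cdim V"
    using finite_dim_basis[OF assms(2)] by metis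
  have "cdim (A ` V) \<le> card (A ` C)"
    using C by (intro cvec.dim_le_card) (auto simp: cspan_image[OF assms(1)])
  then show ?thesis using card_image_le[OF C(1), of A] C(3) by simp
qed

text \<open>A kernel vector in \<open>V\<close> can be completed to a basis of \<open>V\<close>, and it contributes nothing to
  the span of the image.\<close>

lemma cdim_image_less:
  assumes A: "A \<in> bounded_ops" and V: "finite_dim V" "csubspace V"
    and x: "x \<in> V" "x \<noteq> 0" "blinfun_apply A x = 0"
  shows "cdim (blinfun_apply A ` V) < cdim V"
proof -
  have "cvec.independent {x}" using x by (simp add: cvec.dependent_single)
  then obtain C where C: "{x} \<subseteq> C" "C \<subseteq> V" "cvec.independent C" "V \<subseteq> cspan C"
    using cvec.maximal_independent_subset_extend[of "{x}" V] x by auto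
  have fin: "finite C"
    by (rule finite_dim_independent[OF V(1) C(3,2)])
  have card: "card C = cdim V"
    using C by (metis cvec.dim_unique)
  have "A ` C \<subseteq> insert 0 (A ` (C - {x}))" using x by auto
  then have "cspan (A ` C) \<subseteq> cspan (A ` (C - {x}))"
    by (metis cvec.span_insert_0 cvec.span_mono)
  moreover have "A ` V \<subseteq> cspan (A ` C)" using C by (auto simp: cspan_image[OF A])
  ultimately have "cdim (A ` V) \<le> card (A ` (C - {x}))"
    using fin by (intro cvec.dim_le_card) auto
  also have "\<dots> \<le> card (C - {x})" using fin by (intro card_image_le) auto
  also have "\<dots> < card C" using C fin by (intro psubset_card_mono) auto
  finally show ?thesis using card by simp
qed

definition orthonormal :: "'a::complex_inner set \<Rightarrow> bool" where
  "orthonormal E \<longleftrightarrow> (\<forall>x\<in>E. \<forall>y\<in>E. cinner x y = (if x = y then 1 else 0))"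

lemma orthonormal_residual:
  assumes E: "finite E" "orthonormal E" and y: "y \<in> cspan E"
  shows "cinner (x - (\<Sum>e\<in>E. scaleC (cinner x e) e)) y = 0"
proof -
  let ?d = "x - (\<Sum>e\<in>E. scaleC (cinner x e) e)"
  have "cinner ?d e = 0" if "e \<in> E" for e
  proof -
    have "(\<Sum>f\<in>E. cinner x f * cinner f e) = (\<Sum>f\<in>E. if f = e then cinner x f else 0)"
      using E that by (intro sum.cong) (auto simp: orthonormal_def)
    then show ?thesis using E that by (simp add: cinner_linear_simps)
  qed
  then have "cinner y ?d = 0"
    using cspan_orthogonal[OF _ y, of ?d] by (meson cinner_eq_0_commute)
  then show ?thesis by (rule cinner_eq_0_commute[THEN iffD1])
qed

lemma orthonormal_expansion:
  assumes E: "finite E" "orthonormal E" and x: "x \<in> cspan E"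
  shows "x = (\<Sum>e\<in>E. scaleC (cinner x e) e)"
proof -
  let ?d = "x - (\<Sum>e\<in>E. scaleC (cinner x e) e)"
  have "?d \<in> cspan E"
    by (intro cvec.span_diff cvec.span_sum cvec.span_scale x cvec.span_base)
  then have "cinner ?d ?d = 0" by (rule orthonormal_residual[OF E])
  then show ?thesis by simp
qed

lemma orthonormal_independent:
  assumes "orthonormal E"
  shows "cvec.independent E"
proof
  assume "cvec.dependent E"
  then obtain x where x: "x \<in> E" "x \<in> cspan (E - {x})" by (auto simp: cvec.dependent_def)
  have "cinner x x = 0"
    by (rule cspan_orthogonal[OF _ x(2)]) (use assms x in \<open>auto simp: orthonormal_def\<close>)
  moreover have "cinner x x = 1" using assms x(1) unfolding orthonormal_def by metis
  ultimately show False by simp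
qed

text \<open>A new vector is replaced by its residual, which is normalised unless it vanishes.\<close>

lemma gram_schmidt:
  assumes "finite F"
  shows "\<exists>E. finite E \<and> orthonormal E \<and> cspan E = cspan F"
  using assms
proof (induction F)
  case empty
  show ?case by (intro exI[of _ "{}"]) (simp add: orthonormal_def)
next
  case (insert a F)
  then obtain E where E: "finite E" "orthonormal E" "cspan E = cspan F" by blast
  define p where "p = (\<Sum>e\<in>E. scaleC (cinner a e) e)"
  define d where "d = a - p"
  have p: "p \<in> cspan E"
    unfolding p_def by (intro cvec.span_sum cvec.span_scale cvec.span_base)
  have perp: "cinner d y = 0" if "y \<in> cspan E" for y
    unfolding d_def p_def by (rule orthonormal_residual[OF E(1,2) that])
  have span: "cspan (insert a F) = cspan (insert d E)"
  proof -
    have "cspan (insert a F) = cspan (insert a E)"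
      using E(3) by (simp add: cvec.span_insert)
    also have "\<dots> = cspan (insert d E)"
      unfolding d_def using p by (rule cvec.eq_span_insert_eq[of a "a - p" E, simplified])
    finally show ?thesis .
  qed
  show ?case
  proof (cases "d = 0")
    case True
    then show ?thesis using E span cvec.span_insert_0 by metis
  next
    case False
    define u where "u = scaleC (of_real (1 / norm d)) d"
    have "norm u = 1" unfolding u_def scaleC_of_real using False by simp
    then have u1: "cinner u u = 1" by (simp add: cinner_self)
    have perp': "cinner u y = 0" "cinner y u = 0" if "y \<in> E" for y
      using perp[OF cvec.span_base[OF that]] cinner_eq_0_commute[of y d]
      by (simp_all add: u_def cinner_linear_simps)
    have "orthonormal (insert u E)"
      using E(2) u1 perp' by (auto simp: orthonormal_def)
    moreover have "cspan (insert u E) = cspan (insert d E)"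
    proof (rule subset_antisym; rule cvec.span_minimal; simp add: cvec.span_superset)
      have "d = scaleC (of_real (norm d)) u"
        using False by (simp add: u_def scaleC_scaleC)
      also have "\<dots> \<in> cspan (insert u E)"
        by (intro cvec.span_scale cvec.span_base) simp
      finally have "d \<in> cspan (insert u E)" .
      then show "d \<in> cspan (insert u E) \<and> E \<subseteq> cspan (insert u E)"
        by (auto intro: cvec.span_base)
      have "u \<in> cspan (insert d E)"
        unfolding u_def by (intro cvec.span_scale cvec.span_base) simp
      then show "u \<in> cspan (insert d E) \<and> E \<subseteq> cspan (insert d E)"
        by (auto intro: cvec.span_base)
    qed
    ultimately show ?thesis using E(1) span by (intro exI[of _ "insert u E"]) simp
  qed
qed

lemma orthonormal_basis_exists:
  assumes V: "finite_dim V" "csubspace V"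
  obtains e where
    "\<And>a b. a < cdim V \<Longrightarrow> b < cdim V \<Longrightarrow> cinner (e a) (e b) = (if a = b then 1 else 0)"
    "\<And>a. a < cdim V \<Longrightarrow> e a \<in> V"
    "\<And>x. x \<in> V \<Longrightarrow> x = (\<Sum>a<cdim V. scaleC (cinner x (e a)) (e a))"
proof -
  obtain C where C: "finite C" "C \<subseteq> V" "V \<subseteq> cspan C"
    using finite_dim_basis[OF V(1)] by metis
  obtain E where E: "finite E" "orthonormal E" "cspan E = cspan C"
    using gram_schmidt[OF C(1)] by blast
  have EV: "cspan E = V" using C E(3) V(2) by (metis cvec.span_minimal subset_antisym)
  have "cdim V = card E"
    using cvec.dim_span_eq_card_independent[OF orthonormal_independent[OF E(2)]] EV by simp
  then obtain e where e: "bij_betw e {..<cdim V} E"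
    using ex_bij_betw_nat_finite[OF E(1)] by (auto simp: atLeast0LessThan)
  show ?thesis
  proof
    show "cinner (e a) (e b) = (if a = b then 1 else 0)" if "a < cdim V" "b < cdim V" for a b
      using e that E(2) unfolding orthonormal_def bij_betw_def inj_on_def by auto
    show "e a \<in> V" if "a < cdim V" for a
      using e that EV cvec.span_base[of "e a" E] by (auto simp: bij_betw_def)
    show "x = (\<Sum>a<cdim V. scaleC (cinner x (e a)) (e a))" if "x \<in> V" for x
    proof -
      have "x = (\<Sum>e\<in>E. scaleC (cinner x e) e)"
        using orthonormal_expansion[OF E(1,2)] that EV by simp
      also have "\<dots> = (\<Sum>a<cdim V. scaleC (cinner x (e a)) (e a))"
        by (rule sum.reindex_bij_betw[OF e, symmetric])
      finally show ?thesis .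
    qed
  qed
qed

lemma orthogonal_vector_exists:
  assumes "csubspace V" "finite_dim W" "csubspace W" "V \<subset> W"
  obtains w where "w \<in> W" "w \<noteq> 0" "\<And>y. y \<in> V \<Longrightarrow> cinner y w = 0"
proof -
  have "finite_dim V" using assms(2,4) finite_dim_subset by blast
  then obtain C where C: "finite C" "C \<subseteq> V" "V \<subseteq> cspan C"
    using finite_dim_basis by metis
  obtain E where E: "finite E" "orthonormal E" "cspan E = cspan C"
    using gram_schmidt[OF C(1)] by blast
  have EV: "cspan E = V" using C E(3) assms(1) by (metis cvec.span_minimal subset_antisym)
  obtain z where z: "z \<in> W" "z \<notin> V" using assms(4) by auto
  define w where "w = z - (\<Sum>e\<in>E. scaleC (cinner z e) e)"
  have p: "(\<Sum>e\<in>E. scaleC (cinner z e) e) \<in> V"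
    unfolding EV[symmetric] by (intro cvec.span_sum cvec.span_scale cvec.span_base)
  show thesis
  proof
    show "w \<in> W" unfolding w_def using z p assms(3,4) by (intro cvec.subspace_diff) auto
    show "w \<noteq> 0" using z p by (auto simp: w_def)
    show "cinner y w = 0" if "y \<in> V" for y
      using orthonormal_residual[OF E(1,2), of y z] that EV cinner_eq_0_commute by (auto simp: w_def)
  qed
qed

section \<open>The rank of an operator\<close>

lemma finite_rankD: "operator_rank A \<noteq> \<infinity> \<Longrightarrow> finite_dim (range (blinfun_apply A))"
  unfolding operator_rank_def finite_dim_def by metis

lemma operator_rank_eq:
  "finite_dim (range (blinfun_apply A)) \<Longrightarrow> operator_rank A = enat (cdim (range (blinfun_apply A)))"
  unfolding operator_rank_def finite_dim_def by simp

lemma operator_rank_eq_0_iff: "operator_rank A = 0 \<longleftrightarrow> A = 0"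
proof
  assume 0: "operator_rank A = 0"
  then have fin: "finite_dim (range A)" by (intro finite_rankD) simp
  then have "cdim (range A) = 0" using 0 by (simp add: operator_rank_eq zero_enat_def)
  then obtain C where "finite C" "range A \<subseteq> cspan C" "card C = 0"
    using finite_dim_basis[OF fin] by metis
  then have "range A \<subseteq> {0}" by simp
  then show "A = 0" by (intro blinfun_eqI) auto
next
  assume A: "A = 0"
  then have 0: "range A \<subseteq> cspan {}" by auto
  then have "cdim (range A) = 0"
    using cvec.dim_le_card[OF 0] by simp
  then show "operator_rank A = 0"
    using operator_rank_eq[OF finite_dimI[OF finite.emptyI 0]] by (simp add: zero_enat_def)
qed

lemma operator_rank_mono:
  assumes "range (blinfun_apply A) \<subseteq> range (blinfun_apply B)"
  shows "operator_rank A \<le> operator_rank B"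
proof (cases "operator_rank B = \<infinity>")
  case False
  then have B: "finite_dim (range B)" by (rule finite_rankD)
  then show ?thesis
    using cdim_mono[OF B assms] finite_dim_subset[OF B assms] by (simp add: operator_rank_eq)
qed simp

lemma operator_rank_compose_right: "operator_rank (A o\<^sub>L T) \<le> operator_rank A"
  by (rule operator_rank_mono) auto

lemma range_compose: "range (blinfun_apply (T o\<^sub>L A)) = blinfun_apply T ` range (blinfun_apply A)"
  by auto

lemma operator_rank_compose_left:
  assumes "T \<in> bounded_ops"
  shows "operator_rank (T o\<^sub>L A) \<le> operator_rank A"
proof (cases "operator_rank A = \<infinity>")
  case False
  then have A: "finite_dim (range A)" by (rule finite_rankD)
  have TA: "finite_dim (range (T o\<^sub>L A))"
    unfolding range_compose by (rule finite_dim_image[OF assms A])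
  show ?thesis
    unfolding operator_rank_eq[OF A] operator_rank_eq[OF TA] enat_ord_simps
    unfolding range_compose by (rule cdim_image_le[OF assms A])
qed simp

lemma operator_rank_compose_right_eq:
  assumes "A \<in> bounded_ops" "T \<in> bounded_ops"
    and "operator_rank A \<noteq> \<infinity>" "operator_rank A \<le> operator_rank (A o\<^sub>L T)"
  shows "range (blinfun_apply (A o\<^sub>L T)) = range (blinfun_apply A)"
proof (rule csubspace_eqI_cdim)
  show A: "finite_dim (range A)" by (rule finite_rankD[OF assms(3)])
  show sub: "range (A o\<^sub>L T) \<subseteq> range A" by auto
  show "cdim (range A) \<le> cdim (range (A o\<^sub>L T))"
    using assms(4) A finite_dim_subset[OF A sub] by (simp add: operator_rank_eq)
  show "csubspace (range (A o\<^sub>L T))"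
    by (intro csubspace_range bounded_ops_compose assms)
qed

lemma operator_rank_compose_left_eq:
  assumes "A \<in> bounded_ops" "T \<in> bounded_ops"
    and "operator_rank A \<noteq> \<infinity>" "operator_rank A \<le> operator_rank (T o\<^sub>L A)"
    and "T (A x) = 0"
  shows "A x = 0"
proof (rule ccontr)
  assume nz: "A x \<noteq> 0"
  have A: "finite_dim (range A)" by (rule finite_rankD[OF assms(3)])
  have TA: "finite_dim (range (T o\<^sub>L A))"
    unfolding range_compose by (rule finite_dim_image[OF assms(2) A])
  have "cdim (T ` range A) < cdim (range A)"
    by (rule cdim_image_less[OF assms(2) A csubspace_range[OF assms(1)] rangeI nz assms(5)])
  then show False
    using assms(4) unfolding operator_rank_eq[OF A] operator_rank_eq[OF TA] enat_ord_simps
    unfolding range_compose by simp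
qed

text \<open>The range of a partial isometry \<open>A\<close> is fixed by the projection \<open>R = A A\<^sup>*\<close>, and its unit ball
  lies in the image of the unit ball.  If that image is covered by finitely many balls of radius
  \<open>1/2\<close>, then the range is spanned by the \<open>R\<close>-images of the centres: a unit vector of the range
  orthogonal to all of them would have distance at least \<open>1\<close> from each.\<close>

lemma compact_partial_isometry_finite_rank:
  fixes A :: "'a::{complex_inner, complete_space} \<Rightarrow>\<^sub>L 'a"
  assumes A: "partial_isometry A" and cpt: "compact_operator A"
  shows "operator_rank A \<noteq> \<infinity>"
proof -
  have Ab: "A \<in> bounded_ops" using A by (simp add: partial_isometry_def)
  note A' = partial_isometry_cadjoint[OF A]
  define R where "R = A o\<^sub>L cadjoint A"
  have R_fix: "R y = y" if "y \<in> range A" for y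
    using that partial_isometry_triple_apply[OF A] by (auto simp: R_def)
  have R_le: "norm (R y) \<le> norm y" for y
    using partial_isometry_contraction[OF A, of "cadjoint A y"]
      partial_isometry_contraction[OF A', of y] by (simp add: R_def)
  let ?K = "closure (A ` cball 0 1)"
  have "compact ?K" using cpt by (simp add: compact_operator_def)
  moreover have "0 < (1/2 :: real)" by simp
  ultimately have "\<exists>F. finite F \<and> ?K \<subseteq> (\<Union>f\<in>F. ball f (1/2))"
    unfolding compact_eq_totally_bounded by blast
  then obtain F where F: "finite F" "?K \<subseteq> (\<Union>f\<in>F. ball f (1/2))"
    by blast
  obtain E where E: "finite E" "orthonormal E" "cspan E = cspan (R ` F)"
    using gram_schmidt[of "R ` F"] F(1) by auto
  have sub: "cspan E \<subseteq> range A"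
    unfolding E(3) by (rule cvec.span_minimal) (auto simp: R_def csubspace_range[OF Ab])
  have "range A \<subseteq> cspan E"
  proof
    fix z assume z: "z \<in> range A"
    define d where "d = z - (\<Sum>e\<in>E. scaleC (cinner z e) e)"
    show "z \<in> cspan E"
    proof (rule ccontr)
      assume nz: "z \<notin> cspan E"
      have "(\<Sum>e\<in>E. scaleC (cinner z e) e) \<in> cspan E"
        by (intro cvec.span_sum cvec.span_scale cvec.span_base)
      then have d0: "d \<noteq> 0" and d: "d \<in> range A"
        using nz sub z cvec.subspace_diff[OF csubspace_range[OF Ab]] by (auto simp: d_def)
      define y where "y = scaleC (of_real (1 / norm d)) d"
      have "y \<in> range A" unfolding y_def by (rule cvec.subspace_scale[OF csubspace_range[OF Ab] d])
      moreover have "norm y = 1" unfolding y_def scaleC_of_real using d0 by simp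
      ultimately have y: "y \<in> range A" "norm y = 1" .
      have perp: "cinner y v = 0" if "v \<in> cspan E" for v
        using orthonormal_residual[OF E(1,2) that] by (simp add: y_def d_def cinner_scaleC_left)
      have "y = A (cadjoint A y)" using R_fix[OF y(1)] by (simp add: R_def)
      moreover have "cadjoint A y \<in> cball 0 1"
        using partial_isometry_contraction[OF A', of y] y by simp
      ultimately have "y \<in> ?K" by (metis closure_subset imageI subsetD)
      then obtain f where f: "f \<in> F" "dist f y < 1/2" using F(2) by auto
      have "norm (y - R f) \<le> norm (y - f)"
        using R_le[of "y - f"] R_fix[OF y(1)] by (simp add: blinfun.diff_right)
      then have lt: "norm (y - R f) < 1/2" using f(2) by (simp add: dist_norm norm_minus_commute)
      have "R f \<in> cspan E" using f(1) E(3) by (simp add: cvec.span_base)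
      then have "(norm (y + - R f))\<^sup>2 = (norm y)\<^sup>2 + (norm (- R f))\<^sup>2"
        by (intro pythagoras) (simp add: cinner_minus_right perp)
      then have "1\<^sup>2 \<le> (norm (y - R f))\<^sup>2" using y by simp
      then have "1 \<le> norm (y - R f)" by (rule power2_le_imp_le) simp
      then show False using lt by simp
    qed
  qed
  then show ?thesis using operator_rank_eq[OF finite_dimI[OF E(1)]] by simp
qed

text \<open>If composing with \<open>T\<close> does not lower the rank, then \<open>T\<close> is injective on the range
  of \<open>A\<close>, hence \<open>A\<close> and \<open>TA\<close> have the same initial space, on which both preserve norms.\<close>

lemma partial_isometry_norm_compose:
  fixes A T :: "'a::{complex_inner, complete_space} \<Rightarrow>\<^sub>L 'a"
  assumes A: "partial_isometry A" and T: "partial_isometry T" and TA: "partial_isometry (T o\<^sub>L A)"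
    and fin: "operator_rank A \<noteq> \<infinity>" and le: "operator_rank A \<le> operator_rank (T o\<^sub>L A)"
  shows "norm (T (A x)) = norm (A x)"
proof (rule antisym)
  show "norm (T (A x)) \<le> norm (A x)" by (rule partial_isometry_contraction[OF T])
  define y where "y = cadjoint (T o\<^sub>L A) (T (A x))"
  have "(T o\<^sub>L A) y = (T o\<^sub>L A) x"
    unfolding y_def by (metis partial_isometry_triple_apply[OF TA] blinfun_apply_blinfun_compose)
  then have "T (A (x - y)) = 0" by (simp add: blinfun.diff_right)
  then have "A (x - y) = 0"
    by (rule operator_rank_compose_left_eq[OF partial_isometry_bounded_ops[OF A]
          partial_isometry_bounded_ops[OF T] fin le])
  then have "norm (A x) = norm (A y)" by (simp add: blinfun.diff_right)
  also have "\<dots> \<le> norm y" by (rule partial_isometry_contraction[OF A])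
  also have "\<dots> \<le> norm (T (A x))"
    unfolding y_def by (rule partial_isometry_contraction[OF partial_isometry_cadjoint[OF TA]])
  finally show "norm (A x) \<le> norm (T (A x))" .
qed

section \<open>Norm limits of powers\<close>

text \<open>Subsequences are refined once for each index.\<close>

lemma convergent_subsequence_finite:
  fixes f :: "'i \<Rightarrow> nat \<Rightarrow> 'b::heine_borel"
  assumes "finite I" "\<And>i. i \<in> I \<Longrightarrow> bounded (range (f i))"
  shows "\<exists>\<sigma>::nat \<Rightarrow> nat. strict_mono \<sigma> \<and> (\<forall>i\<in>I. convergent (\<lambda>n. f i (\<sigma> n)))"
  using assms
proof (induction I)
  case empty
  show ?case by (intro exI[of _ id]) (simp add: strict_mono_def)
next
  case (insert j I)
  then obtain \<sigma> where \<sigma>: "strict_mono (\<sigma> :: nat \<Rightarrow> nat)" "\<forall>i\<in>I. convergent (\<lambda>n. f i (\<sigma> n))"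
    by auto
  have "bounded (range (\<lambda>n. f j (\<sigma> n)))"
    by (rule bounded_subset[OF insert.prems[of j]]) auto
  then obtain l \<tau> where \<tau>: "strict_mono (\<tau> :: nat \<Rightarrow> nat)" "((\<lambda>n. f j (\<sigma> n)) \<circ> \<tau>) \<longlonglongrightarrow> l"
    using bounded_imp_convergent_subsequence by blast
  have "convergent (\<lambda>n. f i (\<sigma> (\<tau> n)))" if "i \<in> I" for i
    using convergent_subseq_convergent[of "\<lambda>n. f i (\<sigma> n)" \<tau>] \<sigma>(2) \<tau>(1) that by (simp add: o_def)
  moreover have "convergent (\<lambda>n. f j (\<sigma> (\<tau> n)))"
    using \<tau>(2) by (auto simp: convergent_def o_def)
  moreover have "strict_mono (\<lambda>n. \<sigma> (\<tau> n))"
    using strict_mono_o[OF \<sigma>(1) \<tau>(1)] by (simp add: o_def)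
  ultimately show ?case by (intro exI[of _ "\<lambda>n. \<sigma> (\<tau> n)"]) auto
qed

text \<open>An operator living on a finite-dimensional space is controlled by its matrix entries, so the
  preceding lemma applied to the entries gives a Cauchy subsequence.\<close>

lemma Cauchy_subsequence_finite_rank:
  fixes Q :: "'a::{complex_inner, complete_space} \<Rightarrow>\<^sub>L 'a" and X :: "nat \<Rightarrow> 'a \<Rightarrow>\<^sub>L 'a"
  assumes Q: "selfadjoint_projection Q" and fin: "finite_dim (range (blinfun_apply Q))"
    and X: "\<And>n. X n \<in> bounded_ops" "\<And>n. Q o\<^sub>L X n = X n" "\<And>n. X n o\<^sub>L Q = X n"
    and bdd: "\<And>n. norm (X n) \<le> C"
  obtains \<sigma> :: "nat \<Rightarrow> nat" where "strict_mono \<sigma>" "Cauchy (\<lambda>n. X (\<sigma> n))"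
proof -
  define d where "d = cdim (range (blinfun_apply Q))"
  have Qb: "Q \<in> bounded_ops" and QQ: "Q o\<^sub>L Q = Q" and Qsa: "cadjoint Q = Q"
    using Q by (auto simp: selfadjoint_projection_def)
  obtain e where e:
    "\<And>a b. a < d \<Longrightarrow> b < d \<Longrightarrow> cinner (e a) (e b) = (if a = b then 1 else 0)"
    "\<And>a. a < d \<Longrightarrow> e a \<in> range Q"
    "\<And>x. x \<in> range Q \<Longrightarrow> x = (\<Sum>a<d. scaleC (cinner x (e a)) (e a))"
    unfolding d_def
    by (rule orthonormal_basis_exists[OF fin csubspace_range[OF Qb]]) blast
  have e1: "norm (e a) = 1" if "a < d" for a
  proof -
    have "(norm (e a))\<^sup>2 = 1"
      using e(1)[OF that that] by (simp add: cinner_self del: of_real_power)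
    then show ?thesis using power2_eq_imp_eq[of "norm (e a)" 1] by simp
  qed
  have Qe: "Q (e a) = e a" if "a < d" for a
    using e(2)[OF that] QQ by (metis (no_types) blinfun_apply_blinfun_compose imageE)
  define c where "c = (\<lambda>(a, b) n. cinner (X n (e a)) (e b))"
  have entries: "norm (X m - X n) \<le> (\<Sum>(a, b)\<in>{..<d} \<times> {..<d}. cmod (c (a, b) m - c (a, b) n))"
    for m n
  proof (rule norm_blinfun_bound)
    fix x
    define Y where "Y = X m - X n"
    have "X i z = X i (Q z)" "Q (X i z) = X i z" for i z
      using X(2,3)[of i] by (metis blinfun_apply_blinfun_compose)+
    then have YQ: "Y z = Y (Q z)" and QY: "Q (Y z) = Y z" for z
      by (simp_all add: Y_def blinfun.diff_left blinfun.diff_right)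
    have Yc: "Y (scaleC u z) = scaleC u (Y z)" for u z
      by (simp add: Y_def blinfun.diff_left bounded_opsD[OF X(1)] cvec.scale_right_diff_distrib)
    have "Y x = Y (\<Sum>a<d. scaleC (cinner (Q x) (e a)) (e a))"
      using YQ[of x] e(3)[of "Q x"] by simp
    also have "\<dots> = (\<Sum>a<d. scaleC (cinner (Q x) (e a)) (Y (e a)))"
      by (simp add: blinfun.sum_right Yc)
    also have "\<dots> = (\<Sum>a<d. scaleC (cinner x (e a)) (\<Sum>b<d. scaleC (cinner (Y (e a)) (e b)) (e b)))"
    proof (rule sum.cong[OF refl])
      fix a assume "a \<in> {..<d}"
      then have "cinner (Q x) (e a) = cinner x (e a)"
        using cadjoint_works[OF Qb, of x "e a"] Qsa Qe by simp
      moreover have "Y (e a) = (\<Sum>b<d. scaleC (cinner (Y (e a)) (e b)) (e b))"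
        by (rule e(3)) (metis QY rangeI)
      ultimately show "scaleC (cinner (Q x) (e a)) (Y (e a)) =
          scaleC (cinner x (e a)) (\<Sum>b<d. scaleC (cinner (Y (e a)) (e b)) (e b))" by simp
    qed
    also have "norm \<dots> \<le> (\<Sum>a<d. cmod (cinner x (e a)) * (\<Sum>b<d. cmod (cinner (Y (e a)) (e b))))"
      by (intro order_trans[OF norm_sum] sum_mono)
        (simp add: norm_scaleC e1 mult_left_mono order_trans[OF norm_sum])
    also have "\<dots> \<le> (\<Sum>a<d. norm x * (\<Sum>b<d. cmod (cinner (Y (e a)) (e b))))"
      using cmod_cinner_le[of x] e1
      by (intro sum_mono mult_right_mono sum_nonneg) (auto, metis mult.right_neutral)
    also have "\<dots> = (\<Sum>(a, b)\<in>{..<d} \<times> {..<d}. cmod (c (a, b) m - c (a, b) n)) * norm x"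
      by (simp add: c_def Y_def blinfun.diff_left cinner_diff_left sum.cartesian_product[symmetric]
          sum_distrib_left[symmetric] mult.commute)
    finally show "norm ((X m - X n) x) \<le>
        (\<Sum>(a, b)\<in>{..<d} \<times> {..<d}. cmod (c (a, b) m - c (a, b) n)) * norm x"
      by (simp add: Y_def)
  qed (auto intro: sum_nonneg)
  have "bounded (range (c i))" if i_mem: "i \<in> {..<d} \<times> {..<d}" for i
  proof -
    obtain a b where i: "i = (a, b)" "a < d" "b < d" using i_mem by auto
    have "cmod (c i n) \<le> C" for n
    proof -
      have "cmod (c i n) \<le> norm (X n (e a)) * norm (e b)"
        unfolding c_def i by (simp add: cmod_cinner_le)
      also have "\<dots> \<le> norm (X n) * norm (e a) * norm (e b)"
        by (intro mult_right_mono norm_blinfun) simp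
      finally show ?thesis using bdd[of n] e1 i by simp
    qed
    then show ?thesis by (auto intro!: boundedI)
  qed
  then obtain \<sigma> :: "nat \<Rightarrow> nat" where \<sigma>: "strict_mono \<sigma>"
    "\<forall>i\<in>{..<d} \<times> {..<d}. convergent (\<lambda>n. c i (\<sigma> n))"
    using convergent_subsequence_finite[of "{..<d} \<times> {..<d}" c] by auto
  have "Cauchy (\<lambda>n. X (\<sigma> n))"
  proof (rule metric_CauchyI)
    fix \<epsilon> :: real assume \<epsilon>: "0 < \<epsilon>"
    define \<delta> where "\<delta> = \<epsilon> / (real (d * d) + 1)"
    have pos: "0 < real (d * d) + 1" by (rule add_nonneg_pos) simp_all
    have \<delta>: "0 < \<delta>" unfolding \<delta>_def by (rule divide_pos_pos[OF \<epsilon> pos])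
    have "(real (d * d) + 1) * \<delta> = \<epsilon>" using pos by (simp add: \<delta>_def)
    then have \<delta>_sum: "real (d * d) * \<delta> + \<delta> = \<epsilon>" by (simp add: distrib_right)
    have "\<forall>i\<in>{..<d} \<times> {..<d}. \<exists>N. \<forall>m\<ge>N. \<forall>n\<ge>N. dist (c i (\<sigma> m)) (c i (\<sigma> n)) < \<delta>"
      using \<sigma>(2) \<delta> convergent_Cauchy metric_CauchyD by blast
    then obtain N where N:
      "\<And>i m n. i \<in> {..<d} \<times> {..<d} \<Longrightarrow> m \<ge> N i \<Longrightarrow> n \<ge> N i \<Longrightarrow> dist (c i (\<sigma> m)) (c i (\<sigma> n)) < \<delta>"
      by metis
    define M where "M = Max (N ` ({..<d} \<times> {..<d}))"
    have "dist (X (\<sigma> m)) (X (\<sigma> n)) < \<epsilon>" if mn: "m \<ge> M" "n \<ge> M" for m n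
    proof -
      have "dist (X (\<sigma> m)) (X (\<sigma> n)) \<le>
          (\<Sum>(a, b)\<in>{..<d} \<times> {..<d}. cmod (c (a, b) (\<sigma> m) - c (a, b) (\<sigma> n)))"
        using entries by (simp add: dist_norm)
      also have "\<dots> \<le> (\<Sum>(a, b)\<in>{..<d} \<times> {..<d}. \<delta>)"
      proof (rule sum_mono, clarsimp)
        fix a b assume ab: "a < d" "b < d"
        then have "N (a, b) \<le> M" unfolding M_def by (intro Max_ge) auto
        then show "cmod (c (a, b) (\<sigma> m) - c (a, b) (\<sigma> n)) \<le> \<delta>"
          using N[of "(a, b)" m n] ab mn by (auto simp: dist_norm)
      qed
      also have "\<dots> = real (d * d) * \<delta>" by (simp add: case_prod_unfold)
      also have "\<dots> < \<epsilon>" using \<delta> \<delta>_sum by linarith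
      finally show ?thesis .
    qed
    then show "\<exists>M. \<forall>m\<ge>M. \<forall>n\<ge>M. dist (X (\<sigma> m)) (X (\<sigma> n)) < \<epsilon>" by blast
  qed
  with \<sigma>(1) show thesis by (rule that)
qed

text \<open>Here \<open>B\<close> is a unitary on a finite-dimensional space, extended by zero.  Its powers accumulate,
  and since they are isometric there, some \<open>B\<^sup>m\<^sup>+\<^sup>1\<close> with \<open>m \<ge> 1\<close> comes close to the projection
  \<open>B\<^sup>*B\<close>.  Cancelling one factor \<open>B\<close> shows that \<open>B\<^sup>m\<close> comes close to \<open>B\<^sup>*\<close>.\<close>

lemma cadjoint_in_closed_semigroup:
  fixes S :: "('a::{complex_inner, complete_space} \<Rightarrow>\<^sub>L 'a) set"
  assumes S: "operator_semigroup S" "closed S" and B: "B \<in> S" "partial_isometry B"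
    and normal: "cadjoint B o\<^sub>L B = B o\<^sub>L cadjoint B" and fin: "operator_rank B \<noteq> \<infinity>"
  shows "cadjoint B \<in> S"
proof -
  define Q where "Q = cadjoint B o\<^sub>L B"
  have Bb: "B \<in> bounded_ops" using B by (simp add: partial_isometry_def)
  have Q: "selfadjoint_projection Q" using B by (simp add: partial_isometry_def Q_def)
  then have Qb: "Q \<in> bounded_ops" by (simp add: selfadjoint_projection_def)
  have BQ: "B o\<^sub>L Q = B" unfolding Q_def by (rule partial_isometry_triple[OF B(2)])
  have Q2: "Q = B o\<^sub>L cadjoint B" by (simp add: Q_def normal)
  have QB: "Q o\<^sub>L B = B"
    unfolding Q2 blinfun_compose_assoc by (rule partial_isometry_triple[OF B(2)])
  have B'Q: "cadjoint B o\<^sub>L Q = cadjoint B"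
    using arg_cong[OF QB, of cadjoint] Q Bb Qb
    by (simp add: cadjoint_compose selfadjoint_projection_def)
  have norm_le: "norm B \<le> 1" "norm (cadjoint B) \<le> 1"
    using partial_isometry_contraction[OF B(2)]
      partial_isometry_contraction[OF partial_isometry_cadjoint[OF B(2)]]
    by (auto intro!: norm_blinfun_bound)
  have fin': "finite_dim (range Q)"
  proof -
    have "range Q \<subseteq> range B" unfolding Q2 by auto
    then show ?thesis by (rule finite_dim_subset[OF finite_rankD[OF fin]])
  qed
  define X where "X n = ((\<lambda>Z. B o\<^sub>L Z) ^^ n) B" for n
  have X_0: "X 0 = B" and X_Suc: "X (Suc n) = B o\<^sub>L X n" for n by (simp_all add: X_def)
  have XS: "X n \<in> S" for n
    using S(1) B(1) by (induction n) (auto simp: X_0 X_Suc operator_semigroup_def)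
  have Xb: "X n \<in> bounded_ops" for n using XS S(1) by (auto simp: operator_semigroup_def)
  have QX: "Q o\<^sub>L X n = X n" for n
    by (cases n) (simp_all add: X_0 X_Suc QB flip: blinfun_compose_assoc)
  have XQ: "X n o\<^sub>L Q = X n" for n
    by (induction n) (simp_all add: X_0 X_Suc BQ blinfun_compose_assoc)
  have X_add: "X (m + Suc n) = X m o\<^sub>L X n" for m n
    by (induction m) (simp_all add: X_0 X_Suc blinfun_compose_assoc)
  have norm_X: "norm (X n) \<le> 1" for n
  proof (induction n)
    case (Suc n)
    have "norm (B o\<^sub>L X n) \<le> norm B * norm (X n)" by (rule norm_blinfun_compose)
    also have "\<dots> \<le> 1 * 1" using Suc norm_le(1) by (intro mult_mono) auto
    finally show ?case by (simp add: X_Suc)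
  qed (simp add: X_0 norm_le)
  have cancel_B: "norm Z \<le> norm (B o\<^sub>L Z)" if "Q o\<^sub>L Z = Z" for Z
  proof -
    have "norm Z = norm (cadjoint B o\<^sub>L (B o\<^sub>L Z))"
      using that by (simp add: Q_def blinfun_compose_assoc)
    also have "\<dots> \<le> norm (cadjoint B) * norm (B o\<^sub>L Z)" by (rule norm_blinfun_compose)
    also have "\<dots> \<le> 1 * norm (B o\<^sub>L Z)" by (intro mult_right_mono norm_le) simp
    finally show ?thesis by simp
  qed
  have cancel: "norm Z \<le> norm (X n o\<^sub>L Z)" if "Q o\<^sub>L Z = Z" for n Z
  proof (induction n)
    case (Suc n)
    have "Q o\<^sub>L (X n o\<^sub>L Z) = X n o\<^sub>L Z" by (simp add: QX flip: blinfun_compose_assoc)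
    then have "norm (X n o\<^sub>L Z) \<le> norm (B o\<^sub>L (X n o\<^sub>L Z))" by (rule cancel_B)
    then show ?case using Suc by (simp add: X_Suc blinfun_compose_assoc)
  qed (simp add: X_0 cancel_B that)
  obtain \<sigma> :: "nat \<Rightarrow> nat" where \<sigma>: "strict_mono \<sigma>" "Cauchy (\<lambda>n. X (\<sigma> n))"
    by (rule Cauchy_subsequence_finite_rank[OF Q fin' Xb QX XQ norm_X])
  have "\<exists>Y\<in>S. dist Y (cadjoint B) < \<epsilon>" if \<epsilon>: "0 < \<epsilon>" for \<epsilon>
  proof -
    obtain N where N: "\<And>m n. m \<ge> N \<Longrightarrow> n \<ge> N \<Longrightarrow> dist (X (\<sigma> m)) (X (\<sigma> n)) < \<epsilon>"
      using metric_CauchyD[OF \<sigma>(2) \<epsilon>] by blast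
    \<comment> \<open>\<open>X n\<close> is the power \<open>n + 1\<close> of \<open>B\<close>.  Two steps of \<open>\<sigma>\<close> raise the exponent by at least \<open>2\<close>, which
      leaves a positive power of \<open>B\<close> after one factor \<open>B\<close> has been cancelled.\<close>
    have "\<sigma> N < \<sigma> (Suc N)" "\<sigma> (Suc N) < \<sigma> (Suc (Suc N))"
      using \<sigma>(1) by (auto simp: strict_mono_Suc_iff)
    then have "\<sigma> (Suc (Suc N)) = \<sigma> N + Suc (Suc (\<sigma> (Suc (Suc N)) - \<sigma> N - 2))" by linarith
    then obtain m where m: "\<sigma> (Suc (Suc N)) = \<sigma> N + Suc (Suc m)" by blast
    have "norm (X (Suc m) - Q) \<le> norm (X (\<sigma> N) o\<^sub>L (X (Suc m) - Q))"
      using Q by (intro cancel) (simp add: blinfun_compose_diff_right QX selfadjoint_projection_def)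
    also have "\<dots> = dist (X (\<sigma> (Suc (Suc N)))) (X (\<sigma> N))"
      by (simp only: m X_add XQ blinfun_compose_diff_right dist_norm)
    also have "\<dots> < \<epsilon>" by (rule N) auto
    finally have close: "norm (X (Suc m) - Q) < \<epsilon>" .
    have "X m - cadjoint B = cadjoint B o\<^sub>L (X (Suc m) - Q)"
      by (simp add: blinfun_compose_diff_right B'Q X_Suc QX flip: blinfun_compose_assoc Q_def)
    then have "norm (X m - cadjoint B) \<le> norm (cadjoint B) * norm (X (Suc m) - Q)"
      using norm_blinfun_compose by metis
    also have "\<dots> \<le> 1 * norm (X (Suc m) - Q)" by (intro mult_right_mono norm_le) simp
    finally have "dist (X m) (cadjoint B) < \<epsilon>" using close by (simp add: dist_norm)
    then show ?thesis using XS by blast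
  qed
  then have "cadjoint B \<in> closure S" by (auto simp: closure_approachable)
  then show ?thesis using S(2) by (simp add: closure_closed)
qed

section \<open>Countability\<close>

lemma countable_if_separated:
  fixes V :: "'a::metric_space set"
  assumes sep: "separable_space (euclidean :: 'a topology)"
    and d: "0 < d" "\<And>x y. x \<in> V \<Longrightarrow> y \<in> V \<Longrightarrow> x \<noteq> y \<Longrightarrow> d \<le> dist x y"
  shows "countable V"
proof -
  obtain C :: "'a set" where C: "countable C" "closure C = UNIV"
    using sep by (auto simp: separable_space_def)
  have "\<exists>c\<in>C. dist c x < d / 2" for x
  proof -
    have "x \<in> closure C" using C(2) by simp
    then show ?thesis using d(1) half_gt_zero unfolding closure_approachable by blast
  qed
  then obtain f where f: "\<And>x. f x \<in> C" "\<And>x. dist (f x) x < d / 2" by metis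
  have "inj_on f V"
  proof (rule inj_onI, rule ccontr)
    fix x y assume xy: "x \<in> V" "y \<in> V" "f x = f y" "x \<noteq> y"
    have "dist x y \<le> dist (f x) x + dist (f y) y"
      using dist_triangle3[of x y "f x"] xy(3) by (simp add: dist_commute)
    then show False using d(2)[OF xy(1,2,4)] f(2)[of x] f(2)[of y] by simp
  qed
  moreover have "countable (f ` V)" using f(1) by (intro countable_subset[OF _ C(1)]) auto
  ultimately show ?thesis by (metis countable_image_inj_on)
qed

lemma countable_enumeration:
  assumes "countable V"
  obtains k :: enat and h :: "nat \<Rightarrow> 'b" where "bij_betw h {i. enat i < k} V"
proof (cases "finite V")
  case True
  then obtain h where "bij_betw h {0..<card V} V" using ex_bij_betw_nat_finite by blast
  moreover have "{0..<card V} = {i. enat i < enat (card V)}" by auto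
  ultimately show ?thesis using that by metis
next
  case False
  then have "bij_betw (from_nat_into V) UNIV V" by (rule bij_betw_from_nat_into[OF assms])
  moreover have "UNIV = {i. enat i < \<infinity>}" by simp
  ultimately show ?thesis using that by metis
qed

section \<open>Elements of minimal rank\<close>

text \<open>A non-zero compact element is present in the form of a non-zero element of finite rank.\<close>

locale partial_isometry_semigroup =
  fixes S :: "('a::{complex_inner, complete_space} \<Rightarrow>\<^sub>L 'a) set"
  assumes semigroup: "operator_semigroup S"
    and irreducible: "irreducible_ops S"
    and closed: "closed S"
    and partial_isometries: "A \<in> S \<Longrightarrow> partial_isometry A"
    and finite_rank_ex: "\<exists>A\<in>S. A \<noteq> 0 \<and> operator_rank A \<noteq> \<infinity>"
begin

lemma S_compose: "A \<in> S \<Longrightarrow> B \<in> S \<Longrightarrow> A o\<^sub>L B \<in> S"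
  using semigroup by (simp add: operator_semigroup_def)

lemma S_bounded_ops: "A \<in> S \<Longrightarrow> A \<in> bounded_ops"
  using semigroup by (auto simp: operator_semigroup_def)

lemma invariant_subspace_trivial:
  assumes "csubspace M" "closed M" "\<And>T. T \<in> S \<Longrightarrow> blinfun_apply T ` M \<subseteq> M"
  shows "M = {0} \<or> M = UNIV"
proof (rule ccontr)
  assume "\<not> ?thesis"
  then have "csubspace M \<and> closed M \<and> M \<noteq> {0} \<and> M \<noteq> UNIV \<and> (\<forall>A\<in>S. A ` M \<subseteq> M)"
    using assms by simp
  then show False using irreducible unfolding irreducible_ops_def by blast
qed

text \<open>The vectors that are orthogonal to \<open>w\<close> together with their orbits form a closed invariant
  subspace, which is not everything and hence zero.  If the orbit of \<open>x\<close> is orthogonal to \<open>w\<close>, then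
  it lies in this subspace, so \<open>S\<close> annihilates \<open>x\<close>.  But the vectors annihilated by \<open>S\<close> form a closed
  invariant subspace as well, and \<open>S \<noteq> {0}\<close>.\<close>

lemma orbit_not_orthogonal:
  assumes "x \<noteq> 0" "w \<noteq> 0"
  shows "\<exists>T\<in>S. cinner (T x) w \<noteq> 0"
proof (rule ccontr)
  assume "\<not> ?thesis"
  then have 0: "cinner (T x) w = 0" if "T \<in> S" for T using that by blast
  define M where "M = {y. cinner y w = 0 \<and> (\<forall>T\<in>S. cinner (T y) w = 0)}"
  have sub: "csubspace M"
    by (auto simp: M_def cvec.subspace_def cinner_linear_simps blinfun.add_right
        bounded_opsD[OF S_bounded_ops])
  have "M = {y. cinner y w = 0} \<inter> (\<Inter>T\<in>S. {y. cinner (blinfun_apply T y) w = 0})"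
    by (auto simp: M_def)
  moreover have "closed {y. cinner (blinfun_apply T y) w = 0}" for T
    by (intro closed_Collect_eq continuous_on_const
        continuous_on_compose2[OF continuous_on_cinner_left[of UNIV]]) (auto intro: continuous_intros)
  moreover have "closed {y. cinner y w = 0}"
    by (intro closed_Collect_eq continuous_on_const continuous_on_cinner_left)
  ultimately have clo: "closed M" by (auto intro!: closed_Int closed_INT)
  have inv: "T ` M \<subseteq> M" if "T \<in> S" for T
    using that S_compose by (force simp: M_def)
  have not_UNIV: "M \<noteq> UNIV"
  proof
    assume "M = UNIV"
    then have "w \<in> M" by simp
    then show False using assms by (simp add: M_def)
  qed
  have "M = {0}" using invariant_subspace_trivial[OF sub clo inv] not_UNIV by blast
  moreover have "T x \<in> M" if "T \<in> S" for T
    using 0 that S_compose[OF _ that] by (force simp: M_def)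
  ultimately have Tx: "T x = 0" if "T \<in> S" for T using that by auto
  define L where "L = {y. \<forall>T\<in>S. blinfun_apply T y = 0}"
  have sub: "csubspace L"
    by (auto simp: L_def cvec.subspace_def blinfun.add_right bounded_opsD[OF S_bounded_ops])
  have clo: "closed L"
  proof -
    have "L = (\<Inter>T\<in>S. {y. blinfun_apply T y = 0})" by (auto simp: L_def)
    moreover have "closed {y. blinfun_apply T y = 0}" for T :: "'a \<Rightarrow>\<^sub>L 'a"
      by (intro closed_Collect_eq continuous_intros)
    ultimately show ?thesis by (auto intro!: closed_INT)
  qed
  have inv: "T ` L \<subseteq> L" if "T \<in> S" for T
    using that by (force simp: L_def)
  have "x \<in> L" using Tx by (simp add: L_def)
  then have "L = UNIV" using invariant_subspace_trivial[OF sub clo inv] assms(1) by blast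
  then have "A = 0" if "A \<in> S" for A
    using that by (intro blinfun_eqI) (auto simp: L_def)
  then show False using finite_rank_ex by blast
qed

definition min_rank :: enat where
  "min_rank = (LEAST n. n \<in> operator_rank ` S \<and> n \<noteq> 0)"

lemma min_rank_le: "A \<in> S \<Longrightarrow> A \<noteq> 0 \<Longrightarrow> min_rank \<le> operator_rank A"
  unfolding min_rank_def by (rule Least_le) (simp add: operator_rank_eq_0_iff)

lemma min_rank_attained: "\<exists>A\<in>S. A \<noteq> 0 \<and> operator_rank A = min_rank"
proof -
  obtain A where "A \<in> S" "A \<noteq> 0" using finite_rank_ex by blast
  then have "operator_rank A \<in> operator_rank ` S \<and> operator_rank A \<noteq> 0"
    by (simp add: operator_rank_eq_0_iff)
  then have "min_rank \<in> operator_rank ` S \<and> min_rank \<noteq> 0"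
    unfolding min_rank_def by (rule LeastI)
  then show ?thesis by (metis imageE operator_rank_eq_0_iff)
qed

lemma min_rank_finite: "min_rank \<noteq> \<infinity>"
  using finite_rank_ex min_rank_le by (metis enat_ord_simps(5))

definition minimal :: "('a \<Rightarrow>\<^sub>L 'a) \<Rightarrow> bool" where
  "minimal A \<longleftrightarrow> A \<in> S \<and> A \<noteq> 0 \<and> operator_rank A \<le> min_rank"

lemma minimalD:
  assumes "minimal A"
  shows "A \<in> S" "A \<noteq> 0" "operator_rank A = min_rank" "operator_rank A \<noteq> \<infinity>"
    "partial_isometry A" "A \<in> bounded_ops"
  using assms min_rank_le[of A] min_rank_finite partial_isometries[of A] S_bounded_ops[of A]
  by (auto simp: minimal_def)

lemma minimal_left:
  assumes "minimal A" "T \<in> S" "T o\<^sub>L A \<noteq> 0"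
  shows "minimal (T o\<^sub>L A)"
  unfolding minimal_def using assms operator_rank_compose_left[OF S_bounded_ops[OF assms(2)], of A]
  by (auto simp: minimal_def intro: S_compose)

lemma minimal_right:
  assumes "minimal A" "T \<in> S" "A o\<^sub>L T \<noteq> 0"
  shows "minimal (A o\<^sub>L T)"
  unfolding minimal_def using assms operator_rank_compose_right[of A T]
  by (auto simp: minimal_def intro: S_compose)

lemma minimal_left_isometric:
  assumes A: "minimal A" and T: "T \<in> S" "T o\<^sub>L A \<noteq> 0"
  shows "norm (T (A x)) = norm (A x)"
proof (rule partial_isometry_norm_compose)
  show "operator_rank A \<le> operator_rank (T o\<^sub>L A)"
    using minimalD(3)[OF A] minimalD(3)[OF minimal_left[OF A T]] by simp
qed (use minimalD[OF A] minimalD(5)[OF minimal_left[OF A T]] partial_isometries[OF T(1)] in auto)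

lemma minimal_right_range:
  assumes A: "minimal A" and T: "T \<in> S" "A o\<^sub>L T \<noteq> 0"
  shows "range (blinfun_apply (A o\<^sub>L T)) = range (blinfun_apply A)"
  by (rule operator_rank_compose_right_eq)
    (use minimalD[OF A] minimalD(3)[OF minimal_right[OF A T]] S_bounded_ops[OF T(1)] in auto)

text \<open>If \<open>A A \<noteq> 0\<close>, then \<open>A\<close> is isometric on its range, which is
  therefore contained in its initial space.  Both have the same dimension, so they coincide, and
  \<open>A\<close> is a unitary on this space, extended by zero.\<close>

lemma minimal_square_normal:
  assumes A: "minimal A" and AA: "A o\<^sub>L A \<noteq> 0"
  shows "cadjoint A o\<^sub>L A = A o\<^sub>L cadjoint A"
proof -
  note Ab = minimalD(6)[OF A] and Ap = minimalD(5)[OF A]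
  define Q R where "Q = cadjoint A o\<^sub>L A" and "R = A o\<^sub>L cadjoint A"
  have Q: "Q \<in> bounded_ops" "cadjoint Q = Q" and R: "R \<in> bounded_ops" "cadjoint R = R"
    using Ap by (simp_all add: partial_isometry_def selfadjoint_projection_def Q_def R_def)
  have RA: "R (A x) = A x" for x
    using partial_isometry_triple_apply[OF Ap] by (simp add: R_def)
  have QA: "Q (A x) = A x" for x
    using partial_isometry_isometric[OF Ap] minimal_left_isometric[OF A minimalD(1)[OF A] AA]
    by (simp add: Q_def)
  have "range A = range Q"
  proof (rule csubspace_eqI_cdim)
    have fin: "finite_dim (range A)" by (rule finite_rankD[OF minimalD(4)[OF A]])
    have Qimg: "range Q = cadjoint A ` range A" by (auto simp: Q_def)
    show "finite_dim (range Q)" "cdim (range Q) \<le> cdim (range A)"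
      unfolding Qimg using Ab fin by (auto intro: finite_dim_image cdim_image_le)
    show "range A \<subseteq> range Q" using QA by (metis image_subsetI rangeI)
  qed (rule csubspace_range[OF Ab])
  then have RQ: "R (Q x) = Q x" for x using RA by (metis rangeE rangeI)
  have QR: "Q o\<^sub>L R = R" by (intro blinfun_eqI) (simp add: R_def QA)
  have "R o\<^sub>L Q = Q" by (intro blinfun_eqI) (simp add: RQ)
  then have "cadjoint (R o\<^sub>L Q) = Q" using Q by simp
  then have "Q o\<^sub>L R = Q" using Q R by (simp add: cadjoint_compose)
  then show ?thesis using QR by (simp add: Q_def R_def)
qed

lemma minimal_square_cadjoint:
  assumes "minimal A" "A o\<^sub>L A \<noteq> 0"
  shows "cadjoint A \<in> S"
  by (rule cadjoint_in_closed_semigroup[OF semigroup closed])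
    (use minimalD[OF assms(1)] minimal_square_normal[OF assms] in auto)

definition minimal_projection :: "('a \<Rightarrow>\<^sub>L 'a) \<Rightarrow> bool" where
  "minimal_projection P \<longleftrightarrow> minimal P \<and> selfadjoint_projection P"

text \<open>Irreducibility provides \<open>T \<in> S\<close> with \<open>A T A \<noteq> 0\<close>.  The operator \<open>B = A T\<close> has the same range as
  \<open>A\<close>, so it does not vanish on its own range.\<close>

lemma minimal_projection_exists: "\<exists>P. minimal_projection P"
proof -
  obtain A where A: "minimal A"
    using min_rank_attained by (metis minimal_def order_refl)
  note Ab = minimalD(6)[OF A]
  obtain x where x: "A x \<noteq> 0" using minimalD(2)[OF A] by (metis blinfun_eqI zero_blinfun.rep_eq)
  have "cadjoint A (A x) \<noteq> 0"
    using x partial_isometry_triple_apply[OF minimalD(5)[OF A], of x] by auto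
  then obtain T where T: "T \<in> S" "cinner (T (A x)) (cadjoint A (A x)) \<noteq> 0"
    using orbit_not_orthogonal[OF x] by blast
  then have ATAx: "A (T (A x)) \<noteq> 0"
    using cadjoint_works[OF Ab, of "T (A x)" "A x"] by auto
  define B where "B = A o\<^sub>L T"
  have "B (A x) \<noteq> 0" using ATAx by (simp add: B_def)
  then have B0: "B \<noteq> 0" by auto
  have B: "minimal B" unfolding B_def
    using minimal_right[OF A T(1)] B0 by (simp add: B_def)
  have "range B = range A" unfolding B_def
    using minimal_right_range[OF A T(1)] B0 by (simp add: B_def)
  then obtain y where "A x = B y" by (metis rangeE rangeI)
  then have "B (B y) \<noteq> 0" using ATAx by (simp add: B_def)
  then have BB: "B o\<^sub>L B \<noteq> 0" by (rule blinfun_compose_nonzero)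
  have "cadjoint B o\<^sub>L B \<noteq> 0"
    using partial_isometry_triple[OF minimalD(5)[OF B]] B0 by auto
  then have "minimal (cadjoint B o\<^sub>L B)"
    by (rule minimal_left[OF B minimal_square_cadjoint[OF B BB]])
  moreover have "selfadjoint_projection (cadjoint B o\<^sub>L B)"
    using minimalD(5)[OF B] by (simp add: partial_isometry_def)
  ultimately show ?thesis by (auto simp: minimal_projection_def)
qed

end

section \<open>Columns: the elements supported on a minimal projection\<close>

locale semigroup_with_minimal_projection = partial_isometry_semigroup +
  fixes P
  assumes P: "minimal_projection P"
begin

lemma P_S: "P \<in> S" and P_minimal: "minimal P" and P_bounded: "P \<in> bounded_ops"
  and P_nonzero: "P \<noteq> 0" and PP: "P o\<^sub>L P = P" and P_selfadjoint: "cadjoint P = P"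
  using P minimalD[of P] by (auto simp: minimal_projection_def selfadjoint_projection_def)

lemma PP_apply [simp]: "P (P x) = P x"
  by (metis PP blinfun_apply_blinfun_compose)

text \<open>The corner of \<open>S\<close> at \<open>P\<close>, without zero.\<close>

definition corner :: "('a \<Rightarrow>\<^sub>L 'a) set" where
  "corner = {X \<in> S. X \<noteq> 0 \<and> P o\<^sub>L X = X \<and> X o\<^sub>L P = X}"

text \<open>These are the non-zero elements of \<open>S P\<close>.\<close>

definition columns :: "('a \<Rightarrow>\<^sub>L 'a) set" where
  "columns = {D \<in> S. D \<noteq> 0 \<and> D o\<^sub>L P = D}"

lemma columnsD:
  assumes "D \<in> columns"
  shows "D \<in> S" "D \<noteq> 0" "D o\<^sub>L P = D" "D (P x) = D x" "minimal D" "D \<in> bounded_ops"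
    "partial_isometry D"
proof -
  show "D \<in> S" "D \<noteq> 0" "D o\<^sub>L P = D" using assms by (simp_all add: columns_def)
  then show "minimal D" "D (P x) = D x"
    using minimal_left[OF P_minimal, of D] by (simp_all, metis blinfun_apply_blinfun_compose)
  then show "D \<in> bounded_ops" "partial_isometry D" by (simp_all add: minimalD)
qed

lemma columns_isometric:
  assumes D: "D \<in> columns"
  shows "norm (D x) = norm (P x)"
  using minimal_left_isometric[OF P_minimal, of D x] columnsD[OF D] by simp

lemma columns_cadjoint_left:
  assumes D: "D \<in> columns"
  shows "cadjoint D o\<^sub>L D = P"
proof (rule blinfun_eqI)
  fix x
  have "cadjoint D (D (P x)) = P x"
    by (rule partial_isometry_isometric[OF columnsD(7)[OF D]]) (simp add: columns_isometric[OF D])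
  then show "(cadjoint D o\<^sub>L D) x = P x" by (simp add: columnsD(4)[OF D])
qed

lemma corner_columns: "X \<in> corner \<Longrightarrow> X \<in> columns"
  by (simp add: corner_def columns_def)

text \<open>A non-zero element of the corner maps the range of \<open>P\<close> isometrically onto itself.  In particular
  its square does not vanish.\<close>

lemma corner_unitary:
  assumes X: "X \<in> corner"
  shows "cadjoint X o\<^sub>L X = P" "X o\<^sub>L cadjoint X = P" "cadjoint X \<in> corner"
proof -
  note Xc = corner_columns[OF X]
  have PX: "P o\<^sub>L X = X" and X0: "X \<noteq> 0" using X by (simp_all add: corner_def)
  note Xb = columnsD(6)[OF Xc]
  obtain x where x: "X x \<noteq> 0" using X0 by (metis blinfun_eqI zero_blinfun.rep_eq)
  have "norm (X (X x)) = norm (X x)"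
    using columns_isometric[OF Xc, of "X x"] PX by (metis blinfun_apply_blinfun_compose)
  then have XX: "X o\<^sub>L X \<noteq> 0" using x by (intro blinfun_compose_nonzero[of _ _ x]) auto
  show left: "cadjoint X o\<^sub>L X = P" by (rule columns_cadjoint_left[OF Xc])
  then show "X o\<^sub>L cadjoint X = P"
    using minimal_square_normal[OF columnsD(5)[OF Xc] XX] by simp
  have "cadjoint X \<in> S" by (rule minimal_square_cadjoint[OF columnsD(5)[OF Xc] XX])
  moreover have "cadjoint X \<noteq> 0" using left P_nonzero by auto
  moreover have "P o\<^sub>L cadjoint X = cadjoint X" "cadjoint X o\<^sub>L P = cadjoint X"
    using arg_cong[OF PX, of cadjoint] arg_cong[OF columnsD(3)[OF Xc], of cadjoint]
    by (simp_all add: cadjoint_compose P_bounded Xb P_selfadjoint)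
  ultimately show "cadjoint X \<in> corner" by (simp add: corner_def)
qed

text \<open>By irreducibility some \<open>g = P V D\<close> is non-zero, hence unitary on the range of \<open>P\<close>, and \<open>C = g\<^sup>* V\<close> is a left
  inverse of \<open>D\<close> in \<open>S\<close>.  Then \<open>D C\<close> is an idempotent partial isometry, hence self-adjoint, which
  forces \<open>C = D\<^sup>*\<close>.\<close>

lemma columns_cadjoint_S:
  assumes D: "D \<in> columns"
  shows "cadjoint D \<in> S"
proof -
  note D' = columnsD[OF D]
  obtain y where y: "D y \<noteq> 0" using D'(2) by (metis blinfun_eqI zero_blinfun.rep_eq)
  obtain z where z: "P z \<noteq> 0" using P_nonzero by (metis blinfun_eqI zero_blinfun.rep_eq)
  obtain V where V: "V \<in> S" "cinner (V (D y)) (P z) \<noteq> 0"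
    using orbit_not_orthogonal[OF y z] by blast
  define g where "g = P o\<^sub>L (V o\<^sub>L D)"
  have "cinner (g y) z \<noteq> 0"
    using V(2) cadjoint_works[OF P_bounded, of "V (D y)" z] P_selfadjoint by (simp add: g_def)
  then have "g \<noteq> 0" by auto
  then have g: "g \<in> corner"
    unfolding corner_def using V(1) D' P_S
    by (auto simp: g_def blinfun_compose_assoc intro!: S_compose) (simp add: PP flip: blinfun_compose_assoc)
  note g' = corner_unitary[OF g]
  define C where "C = cadjoint g o\<^sub>L V"
  have C: "C \<in> S" using g'(3) V(1) by (auto simp: C_def corner_def intro!: S_compose)
  have PC: "P o\<^sub>L C = C" using g'(3) by (simp add: C_def corner_def flip: blinfun_compose_assoc)
  have CD: "C o\<^sub>L D = P"
  proof -
    have "C o\<^sub>L D = cadjoint g o\<^sub>L (V o\<^sub>L D)" by (simp add: C_def blinfun_compose_assoc)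
    also have "\<dots> = (cadjoint g o\<^sub>L P) o\<^sub>L (V o\<^sub>L D)" using g'(3) by (simp add: corner_def)
    also have "\<dots> = P" using g'(1) by (simp add: blinfun_compose_assoc flip: g_def)
    finally show ?thesis .
  qed
  define F where "F = D o\<^sub>L C"
  have FD: "F o\<^sub>L D = D" by (simp add: F_def blinfun_compose_assoc CD D'(3))
  have "F o\<^sub>L F = F"
    unfolding F_def by (metis FD F_def blinfun_compose_assoc)
  moreover have FS: "F \<in> S" unfolding F_def by (rule S_compose[OF D'(1) C])
  ultimately have F_sa: "cadjoint F = F"
    by (intro partial_isometry_idempotent partial_isometries)
  have "cadjoint D = cadjoint (F o\<^sub>L D)" by (simp add: FD)
  also have "\<dots> = cadjoint D o\<^sub>L F"
    by (simp add: cadjoint_compose S_bounded_ops[OF FS] D'(6) F_sa)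
  also have "\<dots> = P o\<^sub>L C"
    unfolding F_def by (simp add: columns_cadjoint_left[OF D] flip: blinfun_compose_assoc)
  finally show ?thesis using C PC by simp
qed

lemma columns_cadjoint_P:
  assumes D: "D \<in> columns"
  shows "P o\<^sub>L cadjoint D = cadjoint D"
  using arg_cong[OF columnsD(3)[OF D], of cadjoint]
  by (simp add: cadjoint_compose P_bounded columnsD(6)[OF D] P_selfadjoint)

text \<open>The operators \<open>D\<^sup>* A E\<close> are going to be the blocks of \<open>A\<close>.\<close>

lemma entry_in_corner:
  assumes "D \<in> columns" "E \<in> columns" "A \<in> S" "cadjoint D o\<^sub>L (A o\<^sub>L E) \<noteq> 0"
  shows "cadjoint D o\<^sub>L (A o\<^sub>L E) \<in> corner"
  unfolding corner_def
  using assms columns_cadjoint_S[OF assms(1)] columnsD[OF assms(2)] columns_cadjoint_P[OF assms(1)]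
  by (auto simp: blinfun_compose_assoc intro!: S_compose) (simp flip: blinfun_compose_assoc)

text \<open>If \<open>D\<^sup>* E\<close> is non-zero, it is isometric on the range of \<open>P\<close>, so \<open>D\<^sup>*\<close> loses no norm on the range
  of \<open>E\<close>, which thus lies in the range of \<open>D\<close>.\<close>

lemma columns_range_le:
  assumes D: "D \<in> columns" and E: "E \<in> columns" and ne: "cadjoint D o\<^sub>L E \<noteq> 0"
  shows "D o\<^sub>L cadjoint D o\<^sub>L E = E"
proof (rule blinfun_eqI)
  fix x
  have "cadjoint D o\<^sub>L E \<in> columns"
    unfolding columns_def using ne columns_cadjoint_S[OF D] columnsD[OF E]
    by (auto simp: blinfun_compose_assoc intro!: S_compose)
  then have "norm (cadjoint D (E x)) = norm (E x)"
    using columns_isometric[of "cadjoint D o\<^sub>L E" x] columns_isometric[OF E, of x] by simp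
  then have "cadjoint (cadjoint D) (cadjoint D (E x)) = E x"
    by (rule partial_isometry_isometric[OF partial_isometry_cadjoint[OF columnsD(7)[OF D]]])
  then show "(D o\<^sub>L cadjoint D o\<^sub>L E) x = E x" by (simp add: columnsD(6)[OF D])
qed

lemma columns_range_cases:
  assumes D: "D \<in> columns" and E: "E \<in> columns"
  shows "D o\<^sub>L cadjoint D = E o\<^sub>L cadjoint E \<or> cadjoint D o\<^sub>L E = 0"
proof (rule disjCI)
  assume ne: "cadjoint D o\<^sub>L E \<noteq> 0"
  note Db = columnsD(6)[OF D] and Eb = columnsD(6)[OF E]
  have ne': "cadjoint E o\<^sub>L D \<noteq> 0"
  proof
    assume "cadjoint E o\<^sub>L D = 0"
    then have "cadjoint E (D x) = 0" for x by (metis blinfun_apply_blinfun_compose zero_blinfun.rep_eq)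
    then have "cinner y (cadjoint D (E x)) = 0" for x y
      using cadjoint_works[OF Db, of y "E x"] cadjoint_works_right[OF Eb, of "D y" x] by simp
    then have "cadjoint D o\<^sub>L E = 0" by (intro blinfun_eqI cinner_eqI) simp
    then show False using ne by simp
  qed
  let ?F = "D o\<^sub>L cadjoint D" and ?G = "E o\<^sub>L cadjoint E"
  have FG: "?F o\<^sub>L ?G = ?G" and GF: "?G o\<^sub>L ?F = ?F"
    using columns_range_le[OF D E ne] columns_range_le[OF E D ne']
    by (simp_all flip: blinfun_compose_assoc)
  have "?F = cadjoint (?G o\<^sub>L ?F)" unfolding GF by (simp add: cadjoint_compose Db cadjoint_bounded_ops)
  also have "\<dots> = ?F o\<^sub>L ?G"
    using Db Eb by (simp add: cadjoint_compose cadjoint_bounded_ops bounded_ops_compose)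
  finally show "?F = ?G" unfolding FG .
qed

text \<open>If \<open>w \<noteq> 0\<close>, then by irreducibility some \<open>T P z\<close> is not orthogonal to \<open>w\<close>, and \<open>T P\<close> is a
  column.\<close>

lemma columns_total:
  assumes "\<And>D. D \<in> columns \<Longrightarrow> cadjoint D w = 0"
  shows "w = 0"
proof (rule ccontr)
  assume w: "w \<noteq> 0"
  obtain z where z: "P z \<noteq> 0" using P_nonzero by (metis blinfun_eqI zero_blinfun.rep_eq)
  obtain T where T: "T \<in> S" "cinner (T (P z)) w \<noteq> 0"
    using orbit_not_orthogonal[OF z w] by blast
  define D where "D = T o\<^sub>L P"
  have "cinner (D z) w \<noteq> 0" using T(2) by (simp add: D_def)
  then have "D \<noteq> 0" by auto
  then have D: "D \<in> columns"
    using T(1) P_S by (auto simp: columns_def D_def blinfun_compose_assoc PP intro!: S_compose)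
  then have "cinner (D z) w = 0"
    using cadjoint_works[OF columnsD(6)[OF D], of z w] assms[OF D] by simp
  then show False using \<open>cinner (D z) w \<noteq> 0\<close> by simp
qed

text \<open>Projections onto the ranges of columns are equal or orthogonal, so unit vectors chosen from
  different ranges have distance at least \<open>1\<close>; separability makes the family countable.\<close>

lemma orthogonal_columns_exist:
  assumes sep: "separable_space (euclidean :: 'a topology)"
  obtains k :: enat and D :: "nat \<Rightarrow> 'a \<Rightarrow>\<^sub>L 'a" where
    "1 \<le> k" "\<And>i. enat i < k \<Longrightarrow> D i \<in> columns" "\<And>i. \<not> enat i < k \<Longrightarrow> D i = 0"
    "\<And>i j. enat i < k \<Longrightarrow> enat j < k \<Longrightarrow> i \<noteq> j \<Longrightarrow> cadjoint (D i) o\<^sub>L D j = 0"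
    "\<And>w. (\<And>i. enat i < k \<Longrightarrow> cadjoint (D i) w = 0) \<Longrightarrow> w = 0"
proof -
  define proj where "proj D = D o\<^sub>L cadjoint D" for D :: "'a \<Rightarrow>\<^sub>L 'a"
  obtain z where z: "P z \<noteq> 0" using P_nonzero by (metis blinfun_eqI zero_blinfun.rep_eq)
  define p where "p = scaleC (of_real (1 / norm (P z))) (P z)"
  have p: "P p = p" "norm p = 1"
    unfolding p_def bounded_opsD[OF P_bounded] using z by (simp_all add: norm_scaleC norm_divide)
  have "\<forall>F\<in>proj ` columns. \<exists>D. D \<in> columns \<and> proj D = F" by blast
  then obtain col where "\<forall>F\<in>proj ` columns. col F \<in> columns \<and> proj (col F) = F"
    by (rule bchoice[THEN exE])
  then have col: "col F \<in> columns" "proj (col F) = F" if "F \<in> proj ` columns" for F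
    using that by blast+
  define V where "V = (\<lambda>F. col F p) ` proj ` columns"
  have sep1: "1 \<le> dist (col F p) (col G p)"
    if F: "F \<in> proj ` columns" and G: "G \<in> proj ` columns" and "F \<noteq> G" for F G
  proof -
    have "cadjoint (col F) o\<^sub>L col G = 0"
      using columns_range_cases[of "col F" "col G"] col[OF F] col[OF G] \<open>F \<noteq> G\<close> by (auto simp: proj_def)
    then have "cadjoint (col F) (col G p) = 0"
      by (metis blinfun_apply_blinfun_compose zero_blinfun.rep_eq)
    then have "cinner (col F p) (- col G p) = 0"
      using cadjoint_works[OF columnsD(6), of "col F" p "col G p"] col[OF F]
      by (simp add: cinner_minus_right)
    then have "(norm (col F p - col G p))\<^sup>2 = (norm (col F p))\<^sup>2 + (norm (col G p))\<^sup>2"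
      using pythagoras[of "col F p" "- col G p"] by simp
    also have "\<dots> = 2"
      using columns_isometric[of "col F" p] columns_isometric[of "col G" p] col[OF F] col[OF G] p by simp
    finally have "1\<^sup>2 \<le> (norm (col F p - col G p))\<^sup>2" by simp
    then show ?thesis unfolding dist_norm by (rule power2_le_imp_le) simp
  qed
  have "countable V"
    by (rule countable_if_separated[OF sep, of 1]) (auto simp: V_def intro: sep1)
  moreover have "inj_on (\<lambda>F. col F p) (proj ` columns)"
    by (rule inj_onI, rule ccontr) (use sep1 in force)
  ultimately have "countable (proj ` columns)"
    unfolding V_def by (rule countable_image_inj_on)
  then obtain k :: enat and h where h: "bij_betw h {i. enat i < k} (proj ` columns)"
    by (rule countable_enumeration)
  define D where "D i = (if enat i < k then col (h i) else 0)" for i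
  have hi: "h i \<in> proj ` columns" if "enat i < k" for i
    using h that by (auto simp: bij_betw_def)
  have Dc: "D i \<in> columns" "proj (D i) = h i" if "enat i < k" for i
    using col[OF hi[OF that]] that by (simp_all add: D_def)
  show thesis
  proof
    have "P \<in> columns" by (simp add: columns_def P_S P_nonzero PP)
    then obtain i where "enat i < k" using h by (force simp: bij_betw_def)
    then show "1 \<le> k"
      by (metis ileI1 order_trans not_le enat_0 gr_zeroI i0_lb one_eSuc not_less_zero leD)
    show "D i \<in> columns" if "enat i < k" for i by (rule Dc(1)[OF that])
    show "D i = 0" if "\<not> enat i < k" for i using that by (simp add: D_def)
    show "cadjoint (D i) o\<^sub>L D j = 0" if ij: "enat i < k" "enat j < k" "i \<noteq> j" for i j
    proof -
      have "h i \<noteq> h j" using h ij by (auto simp: bij_betw_def inj_on_def)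
      then show ?thesis
        using columns_range_cases[OF Dc(1)[OF ij(1)] Dc(1)[OF ij(2)]] Dc(2)[OF ij(1)] Dc(2)[OF ij(2)]
        by (auto simp: proj_def)
    qed
    show "w = 0" if w: "\<And>i. enat i < k \<Longrightarrow> cadjoint (D i) w = 0" for w
    proof (rule columns_total)
      fix E assume E: "E \<in> columns"
      then obtain i where i: "enat i < k" "h i = proj E" using h by (force simp: bij_betw_def)
      have "proj E w = 0" using w[OF i(1)] Dc(2)[OF i(1)] i(2) by (metis proj_def
            blinfun_apply_blinfun_compose blinfun.zero_right)
      moreover have "cadjoint E (E (cadjoint E w)) = cadjoint E w"
        using partial_isometry_triple_apply[OF partial_isometry_cadjoint[OF columnsD(7)[OF E]], of w]
        by (simp add: columnsD(6)[OF E])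
      ultimately show "cadjoint E w = 0" by (simp add: proj_def)
    qed
  qed
qed

text \<open>Irreducibility of \<open>S\<close> passes to the corner, since \<open>\<langle>T x, w\<rangle> = \<langle>P T P x, w\<rangle>\<close> for \<open>x\<close>, \<open>w\<close> in the
  range of \<open>P\<close>.\<close>

lemma corner_orbit_not_orthogonal:
  assumes x: "P x = x" "x \<noteq> 0" and w: "P w = w" "w \<noteq> 0"
  shows "\<exists>X\<in>corner. cinner (X x) w \<noteq> 0"
proof -
  obtain T where T: "T \<in> S" "cinner (T x) w \<noteq> 0" using orbit_not_orthogonal[OF x(2) w(2)] by blast
  define X where "X = P o\<^sub>L (T o\<^sub>L P)"
  have "cinner (X x) w = cinner (T x) w"
    using cadjoint_works[OF P_bounded, of "T x" w] by (simp add: X_def P_selfadjoint x w)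
  then have ne: "cinner (X x) w \<noteq> 0" using T(2) by simp
  then have "X \<noteq> 0" by auto
  then have "X \<in> corner"
    using T(1) P_S by (auto simp: corner_def X_def blinfun_compose_assoc PP intro!: S_compose)
      (simp add: PP flip: blinfun_compose_assoc)
  then show ?thesis using ne by blast
qed

text \<open>For two orthogonal columns \<open>D\<close>, \<open>E\<close> and \<open>z\<close> in the range of \<open>P\<close> there are orthogonal vectors
  of norm \<open>\<parallel>z\<parallel>\<close> in the ranges of \<open>D\<close> and \<open>E\<close> that \<open>B\<close> maps to \<open>z\<close>.  Their sum has norm \<open>\<surd>2 \<parallel>z\<parallel>\<close> and
  is mapped to \<open>2 z\<close>, although \<open>B\<close> is a contraction.\<close>

lemma row_entry_unique:
  assumes D: "D \<in> columns" and E: "E \<in> columns" and DE: "cadjoint D o\<^sub>L E = 0"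
    and B: "B \<in> S" and BD: "B o\<^sub>L D \<in> corner" and BE: "B o\<^sub>L E \<in> corner"
  shows False
proof -
  obtain y where y: "P y \<noteq> 0" using P_nonzero by (metis blinfun_eqI zero_blinfun.rep_eq)
  define z where "z = P y"
  have z: "P z = z" "z \<noteq> 0" using y by (simp_all add: z_def)
  have preimage: "\<exists>v. B (F v) = z \<and> norm (F v) = norm z"
    if F: "F \<in> columns" and BF: "B o\<^sub>L F \<in> corner" for F
  proof (intro exI conjI)
    let ?v = "cadjoint (B o\<^sub>L F) z"
    note g = corner_unitary[OF BF]
    show "B (F ?v) = z" using g(2) z(1) by (metis blinfun_apply_blinfun_compose)
    have "P ?v = ?v" using g(3) unfolding corner_def by (metis (mono_tags, lifting)
          blinfun_apply_blinfun_compose mem_Collect_eq)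
    then show "norm (F ?v) = norm z"
      using columns_isometric[OF F, of ?v] columns_isometric[OF corner_columns[OF g(3)], of z] z(1)
      by simp
  qed
  obtain v where v: "B (D v) = z" "norm (D v) = norm z" using preimage[OF D BD] by blast
  obtain w where w: "B (E w) = z" "norm (E w) = norm z" using preimage[OF E BE] by blast
  have "cadjoint D (E w) = 0" using DE by (metis blinfun_apply_blinfun_compose zero_blinfun.rep_eq)
  then have "cinner (D v) (E w) = 0" by (simp add: cadjoint_works[OF columnsD(6)[OF D]])
  then have sq: "(norm (D v + E w))\<^sup>2 = 2 * (norm z)\<^sup>2" by (simp add: pythagoras v w)
  have "norm (B (D v + E w)) \<le> norm (D v + E w)"
    by (rule partial_isometry_contraction[OF partial_isometries[OF B]])
  moreover have "norm (B (D v + E w)) = 2 * norm z"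
    by (simp add: blinfun.add_right v w flip: scaleR_2)
  ultimately have "2 * norm z \<le> norm (D v + E w)" by simp
  then have "(2 * norm z)\<^sup>2 \<le> (norm (D v + E w))\<^sup>2" by (rule power_mono) simp
  then have "(2 * norm z)\<^sup>2 \<le> 2 * (norm z)\<^sup>2" unfolding sq .
  then show False using z(2) by (simp add: power_mult_distrib)
qed

text \<open>The range of \<open>F\<close> would have to equal both the range of \<open>D\<close> and that of \<open>E\<close>.\<close>

lemma column_entry_unique:
  assumes D: "D \<in> columns" and E: "E \<in> columns" and DE: "cadjoint D o\<^sub>L E = 0"
    and F: "F \<in> columns" "cadjoint D o\<^sub>L F \<noteq> 0" "cadjoint E o\<^sub>L F \<noteq> 0"
  shows False
proof -
  have "D o\<^sub>L cadjoint D = E o\<^sub>L cadjoint E"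
    using columns_range_cases[OF D F(1)] columns_range_cases[OF E F(1)] F(2,3) by simp
  then have "E o\<^sub>L (cadjoint E o\<^sub>L E) = D o\<^sub>L (cadjoint D o\<^sub>L E)"
    by (metis blinfun_compose_assoc)
  also have "\<dots> = 0" by (simp add: DE)
  finally show False using columnsD(2,3)[OF E] columns_cadjoint_left[OF E] by simp
qed

end

section \<open>Orthonormal bases indexed by blocks\<close>

locale block_basis =
  fixes k :: enat and r :: nat and u :: "nat \<Rightarrow> nat \<Rightarrow> 'a::{complex_inner, complete_space}"
  assumes orthonormal_blocks: "a < r \<Longrightarrow> b < r \<Longrightarrow>
      cinner (u i a) (u j b) = (if i = j \<and> a = b \<and> enat i < k then 1 else 0)"
    and total: "(\<And>i b. enat i < k \<Longrightarrow> b < r \<Longrightarrow> cinner x (u i b) = 0) \<Longrightarrow> x = 0"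
begin

lemma u_eq_0: "\<not> enat i < k \<Longrightarrow> b < r \<Longrightarrow> u i b = 0"
  using orthonormal_blocks[of b b i i] by simp

definition W :: "'a \<Rightarrow> nat \<Rightarrow> complex Matrix.vec" where
  "W x i = Matrix.vec r (\<lambda>b. cinner x (u i b))"

text \<open>The component in the \<open>i\<close>-th block of the vector with coordinates \<open>v\<close>.\<close>

definition block_vector :: "(nat \<Rightarrow> complex Matrix.vec) \<Rightarrow> nat \<Rightarrow> 'a" where
  "block_vector v i = (\<Sum>b<r. scaleC (vec_index (v i) b) (u i b))"

lemma W_carrier [simp]: "W x i \<in> carrier_vec r"
  by (simp add: W_def)

lemma W_dim [simp]: "dim_vec (W x i) = r"
  by (simp add: W_def)

lemma W_index [simp]: "b < r \<Longrightarrow> vec_index (W x i) b = cinner x (u i b)"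
  by (simp add: W_def)

lemma cscalar_prod_eq: "w \<in> carrier_vec r \<Longrightarrow> v \<bullet>c w = (\<Sum>b<r. vec_index v b * cnj (vec_index w b))"
  by (simp add: scalar_prod_def atLeast0LessThan)

lemma cinner_block_vector_basis:
  assumes "b < r" "v \<in> dsum k r"
  shows "cinner (block_vector v i) (u j b) = (if i = j then vec_index (v j) b else 0)"
proof -
  have "cinner (block_vector v i) (u j b) =
      (\<Sum>a<r. if a = b then (if i = j \<and> enat i < k then vec_index (v i) b else 0) else 0)"
    unfolding block_vector_def cinner_sum_left cinner_scaleC_left
    using assms(1) by (intro sum.cong) (auto simp: orthonormal_blocks)
  then show ?thesis using assms by (auto simp: dsum_def)
qed

lemma cinner_block_vector_left: "cinner (block_vector v i) y = v i \<bullet>c W y i"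
  unfolding block_vector_def cinner_sum_left cinner_scaleC_left
  by (simp add: cscalar_prod_eq flip: cinner_commute)

lemma cinner_block_vector:
  assumes "v \<in> dsum k r" "w \<in> dsum k r"
  shows "cinner (block_vector v i) (block_vector w j) = (if i = j then v i \<bullet>c w i else 0)"
proof -
  have w: "w i \<in> carrier_vec r" using assms(2) by (simp add: dsum_def)
  have "cinner (block_vector v i) (block_vector w j) = (\<Sum>b<r. cnj (vec_index (w j) b) * (if i = j then vec_index (v j) b else 0))"
    unfolding block_vector_def[of w] cinner_sum_right cinner_scaleC_right
    using assms by (intro sum.cong) (auto simp: cinner_block_vector_basis)
  also have "\<dots> = (if i = j then v i \<bullet>c w i else 0)"
    using w by (auto simp: cscalar_prod_eq mult.commute)
  finally show ?thesis .
qed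

lemma cscalar_prod_self_nonneg:
  assumes "v \<in> dsum k r"
  shows "0 \<le> Re (v i \<bullet>c v i)"
  using cinner_block_vector[OF assms assms, of i i] by (metis Re_complex_of_real cinner_self zero_le_power2)

lemma norm_sum_block_vector:
  assumes v: "v \<in> dsum k r" and "finite I"
  shows "(norm (\<Sum>i\<in>I. block_vector v i))\<^sup>2 = (\<Sum>i\<in>I. Re (v i \<bullet>c v i))"
proof -
  have "(norm (\<Sum>i\<in>I. block_vector v i))\<^sup>2 = Re (cinner (\<Sum>i\<in>I. block_vector v i) (\<Sum>i\<in>I. block_vector v i))"
    by (simp add: cinner_self)
  also have "\<dots> = (\<Sum>i\<in>I. Re (v i \<bullet>c v i))"
    using assms(2) by (simp add: cinner_sum_left cinner_sum_right cinner_block_vector[OF v v])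
  finally show ?thesis .
qed

text \<open>The Riesz--Fischer theorem: by orthogonality the increments of the partial sums have the same
  squared norms as the increments of a convergent numerical series.\<close>

lemma block_vector_sums:
  assumes v: "v \<in> dsum k r"
  obtains x where "block_vector v sums x" "W x = v"
proof -
  define s where "s n = (\<Sum>i<n. block_vector v i)" for n
  define t where "t n = (\<Sum>i<n. Re (v i \<bullet>c v i))" for n
  have "summable (\<lambda>i. Re (v i \<bullet>c v i))"
    using v cscalar_prod_self_nonneg[OF v] by (auto simp: dsum_def summable_on_UNIV_nonneg_real_iff)
  then have "Cauchy t" unfolding t_def by (simp add: summable_iff_convergent convergent_Cauchy)
  have le: "(dist (s m) (s n))\<^sup>2 = dist (t m) (t n)" if "n \<le> m" for m n
  proof -
    have s: "s m - s n = (\<Sum>i\<in>{n..<m}. block_vector v i)" and t: "t m - t n = (\<Sum>i\<in>{n..<m}. Re (v i \<bullet>c v i))"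
      using that by (simp_all add: s_def t_def sum_diff_nat_ivl lessThan_atLeast0)
    have "0 \<le> t m - t n" unfolding t by (intro sum_nonneg cscalar_prod_self_nonneg[OF v])
    then show ?thesis
      using norm_sum_block_vector[OF v, of "{n..<m}"] s t by (simp add: dist_norm)
  qed
  have "(dist (s m) (s n))\<^sup>2 = dist (t m) (t n)" for m n
    using le[of m n] le[of n m] by (cases "n \<le> m") (simp_all add: dist_commute)
  have "Cauchy s"
  proof (rule metric_CauchyI)
    fix \<epsilon> :: real assume \<epsilon>: "0 < \<epsilon>"
    obtain N where N: "\<And>m n. N \<le> m \<Longrightarrow> N \<le> n \<Longrightarrow> dist (t m) (t n) < \<epsilon>\<^sup>2"
      using metric_CauchyD[OF \<open>Cauchy t\<close>, of "\<epsilon>\<^sup>2"] \<epsilon> by auto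
    have "dist (s m) (s n) < \<epsilon>" if "N \<le> m" "N \<le> n" for m n
    proof (rule power2_less_imp_less)
      show "(dist (s m) (s n))\<^sup>2 < \<epsilon>\<^sup>2"
        using N[OF that] \<open>(dist (s m) (s n))\<^sup>2 = dist (t m) (t n)\<close> by simp
    qed (use \<epsilon> in simp)
    then show "\<exists>N. \<forall>m\<ge>N. \<forall>n\<ge>N. dist (s m) (s n) < \<epsilon>" by blast
  qed
  then obtain x where "s \<longlonglongrightarrow> x" using Cauchy_convergent convergent_def by blast
  then have x: "block_vector v sums x" by (simp add: sums_def s_def[abs_def])
  have dim: "dim_vec (v i) = r" for i using v unfolding dsum_def by auto
  have "W x = v"
  proof (intro ext eq_vecI)
    fix i b assume "b < dim_vec (v i)"
    then have br: "b < r" by (simp add: dim)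
    have "(\<lambda>n. cinner (\<Sum>i<n. block_vector v i) (u i b)) \<longlonglongrightarrow> cinner x (u i b)"
      using x unfolding sums_def by (rule tendsto_cinner_left)
    then have "(\<lambda>j. if j = i then vec_index (v i) b else 0) sums cinner x (u i b)"
      by (simp add: sums_def cinner_sum_left cinner_block_vector_basis[OF br v])
    moreover have "(\<lambda>j. if j = i then vec_index (v i) b else 0) sums vec_index (v i) b"
      by (rule sums_single)
    ultimately show "vec_index (W x i) b = vec_index (v i) b"
      using br sums_unique2 by simp
  qed (simp add: dim W_def)
  then show thesis using x that by blast
qed

text \<open>Bessel's inequality: a finite partial sum \<open>p\<close> of the expansion of \<open>x\<close> satisfies
  \<open>\<parallel>p\<parallel>\<^sup>2 = \<langle>p, x\<rangle>\<close>.\<close>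

lemma W_dsum: "W x \<in> dsum k r"
proof -
  have W0: "W x i = 0\<^sub>v r" if "\<not> enat i < k" for i
    by (rule eq_vecI) (simp_all add: W_def u_eq_0[OF that])
  have bound: "(\<Sum>i<n. Re (W x i \<bullet>c W x i)) \<le> (norm x)\<^sup>2" for n
  proof -
    define v where "v i = (if i < n then W x i else 0\<^sub>v r)" for i
    have "(\<lambda>i. Re (v i \<bullet>c v i)) summable_on UNIV"
      by (rule finite_nonzero_values_imp_summable_on, rule finite_subset[of _ "{..<n}"])
        (auto simp: v_def split: if_splits)
    then have v: "v \<in> dsum k r" by (auto simp: dsum_def v_def W0)
    define p where "p = (\<Sum>i<n. block_vector v i)"
    have p: "(norm p)\<^sup>2 = (\<Sum>i<n. Re (W x i \<bullet>c W x i))"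
      unfolding p_def norm_sum_block_vector[OF v finite_lessThan] by (simp add: v_def)
    also have "\<dots> = Re (cinner p x)"
      by (simp add: p_def cinner_sum_left cinner_block_vector_left v_def)
    also have "\<dots> \<le> norm p * norm x"
      using complex_Re_le_cmod cmod_cinner_le by (rule order_trans)
    finally have "norm p \<le> norm x" by (cases "p = 0") (simp_all add: power2_eq_square)
    then show ?thesis unfolding p[symmetric] by (simp add: power_mono)
  qed
  have nonneg: "0 \<le> Re (W x i \<bullet>c W x i)" for i
    by (simp add: cscalar_prod_eq sum_nonneg flip: complex_norm_square)
  then have "summable (\<lambda>i. Re (W x i \<bullet>c W x i))"
    by (rule summableI_nonneg_bounded[OF _ bound])
  then show ?thesis
    using nonneg by (auto simp: dsum_def W0 summable_on_UNIV_nonneg_real_iff)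
qed

lemma W_add: "W (x + y) = (\<lambda>i. W x i + W y i)"
  by (intro ext eq_vecI) (simp_all add: W_def cinner_add_left)

lemma W_scaleC: "W (scaleC c x) = (\<lambda>i. c \<cdot>\<^sub>v W x i)"
  by (intro ext eq_vecI) (simp_all add: W_def cinner_scaleC_left)

lemma W_inj: "inj W"
proof (rule injI)
  fix x y assume "W x = W y"
  then have "cinner (x - y) (u i b) = 0" if "b < r" for i b
    using W_index[OF that, of x i] W_index[OF that, of y i] by (simp add: cinner_diff_left)
  then have "x - y = 0" by (intro total)
  then show "x = y" by simp
qed

lemma W_expansion: "block_vector (W x) sums x"
proof -
  obtain y where "block_vector (W x) sums y" "W y = W x" by (rule block_vector_sums[OF W_dsum])
  then show ?thesis using W_inj by (metis injD)
qed

lemma W_surj: "W ` UNIV = dsum k r"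
proof
  show "dsum k r \<subseteq> range W" by (metis rangeI subsetI block_vector_sums)
qed (use W_dsum in auto)

lemma W_cinner: "dsum_inner (W x) (W y) = cinner x y"
proof -
  let ?f = "\<lambda>i. W x i \<bullet>c W y i"
  have f: "cinner (block_vector (W x) i) (block_vector (W y) i) = ?f i" for i
    by (simp add: cinner_block_vector[OF W_dsum W_dsum])
  have sq: "Re (W z i \<bullet>c W z i) = (norm (block_vector (W z) i))\<^sup>2" for z i
    using cinner_block_vector[OF W_dsum W_dsum, of z i z i] by (simp add: cinner_self) (metis Re_complex_of_real of_real_power)
  have sm: "summable (\<lambda>i. (norm (block_vector (W z) i))\<^sup>2)" for z
    using W_dsum[of z] by (simp add: dsum_def sq summable_on_UNIV_nonneg_real_iff)
  have "cmod (?f i) \<le> (norm (block_vector (W x) i))\<^sup>2 + (norm (block_vector (W y) i))\<^sup>2" for i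
  proof -
    have "cmod (?f i) \<le> norm (block_vector (W x) i) * norm (block_vector (W y) i)"
      unfolding f[symmetric] by (rule cmod_cinner_le)
    also have "\<dots> \<le> (norm (block_vector (W x) i))\<^sup>2 + (norm (block_vector (W y) i))\<^sup>2"
    proof -
      have "0 \<le> norm (block_vector (W x) i) * norm (block_vector (W y) i)" by simp
      then show ?thesis
        using sum_squares_bound[of "norm (block_vector (W x) i)" "norm (block_vector (W y) i)"]
        unfolding mult.assoc by linarith
    qed
    finally show ?thesis .
  qed
  then have "summable (\<lambda>i. norm (?f i))"
    by (intro summable_comparison_test'[OF summable_add[OF sm[of x] sm[of y]]]) simp
  moreover have "?f sums cinner x y"
  proof -
    have "(\<lambda>n. cinner (\<Sum>i<n. block_vector (W x) i) y) \<longlonglongrightarrow> cinner x y"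
      using W_expansion[of x] unfolding sums_def by (rule tendsto_cinner_left)
    then show ?thesis by (simp add: sums_def cinner_sum_left cinner_block_vector_left)
  qed
  ultimately have "(?f has_sum cinner x y) UNIV" by (rule norm_summable_imp_has_sum)
  then show ?thesis unfolding dsum_inner_def by (rule infsumI)
qed

lemma unitary_W: "unitary_onto_dsum k r W"
  unfolding unitary_onto_dsum_def bij_betw_def
  using W_inj W_surj W_add W_scaleC W_cinner by blast

lemma dsum_norm_W: "dsum_norm (W x) = norm x"
  by (simp add: dsum_norm_def W_cinner cinner_self)

lemma W_inv [simp]: "inv_into UNIV W (W x) = x"
  by (simp add: W_inj)

section \<open>Operators in block form\<close>

lemma unitary_conj_W [simp]: "unitary_conj k r W A (W x) = W (A x)"
  by (simp add: unitary_conj_def W_dsum)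

lemma unitary_conj_dsum_ops:
  assumes "A \<in> bounded_ops"
  shows "unitary_conj k r W A \<in> dsum_ops k r"
proof -
  have dsumE: "\<exists>x. v = W x" if "v \<in> dsum k r" for v using W_surj that by blast
  have "unitary_conj k r W A (\<lambda>i. v i + w i) =
      (\<lambda>i. unitary_conj k r W A v i + unitary_conj k r W A w i)"
    if v: "v \<in> dsum k r" and w: "w \<in> dsum k r" for v w
  proof -
    obtain x y where "v = W x" "w = W y" using dsumE[OF v] dsumE[OF w] by blast
    then show ?thesis by (simp add: blinfun.add_right flip: W_add)
  qed
  moreover have "unitary_conj k r W A (\<lambda>i. c \<cdot>\<^sub>v v i) = (\<lambda>i. c \<cdot>\<^sub>v unitary_conj k r W A v i)"
    if v: "v \<in> dsum k r" for c v
  proof -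
    obtain x where "v = W x" using dsumE[OF v] by blast
    then show ?thesis by (simp add: bounded_opsD[OF assms] flip: W_scaleC)
  qed
  moreover have "dsum_norm (unitary_conj k r W A v) \<le> norm A * dsum_norm v"
    if v: "v \<in> dsum k r" for v
  proof -
    obtain x where "v = W x" using dsumE[OF v] by blast
    then show ?thesis by (simp add: dsum_norm_W norm_blinfun)
  qed
  moreover have "unitary_conj k r W A \<in> dsum k r \<rightarrow>\<^sub>E dsum k r"
    by (auto simp: unitary_conj_def W_dsum)
  ultimately show ?thesis unfolding dsum_ops_def by blast
qed

text \<open>Conversely every bounded operator on the direct sum is of this form, by transport along the
  inverse of \<open>W\<close>.\<close>

lemma dsum_ops_unitary_conj:
  assumes T: "T \<in> dsum_ops k r"
  obtains A where "A \<in> bounded_ops" "unitary_conj k r W A = T"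
proof -
  have maps: "T v \<in> dsum k r" if "v \<in> dsum k r" for v
    using T that unfolding dsum_ops_def by blast
  have ext: "T \<in> extensional (dsum k r)"
    using T unfolding dsum_ops_def PiE_def by blast
  have add: "T (\<lambda>i. W x i + W y i) = (\<lambda>i. T (W x) i + T (W y) i)" for x y
    using T W_dsum unfolding dsum_ops_def by blast
  have scale: "T (\<lambda>i. c \<cdot>\<^sub>v W x i) = (\<lambda>i. c \<cdot>\<^sub>v T (W x) i)" for c x
    using T W_dsum unfolding dsum_ops_def by blast
  obtain C where C: "\<And>v. v \<in> dsum k r \<Longrightarrow> dsum_norm (T v) \<le> C * dsum_norm v"
    using T unfolding dsum_ops_def by blast
  define f where "f x = inv_into UNIV W (T (W x))" for x
  have Wf: "W (f x) = T (W x)" for x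
    unfolding f_def using maps[OF W_dsum] W_surj by (metis f_inv_into_f)
  have f_add: "f (x + y) = f x + f y" for x y
    by (rule injD[OF W_inj]) (simp add: Wf W_add add)
  have f_scale: "f (scaleC c x) = scaleC c (f x)" for c x
    by (rule injD[OF W_inj]) (simp add: Wf W_scaleC scale)
  have "bounded_linear f"
  proof (rule bounded_linear_intro[where K = C])
    show "f (s *\<^sub>R x) = s *\<^sub>R f x" for s x
      using f_scale[of "of_real s" x] by (simp add: scaleC_of_real)
    show "norm (f x) \<le> norm x * C" for x
      using C[OF W_dsum[of x]] by (simp add: mult.commute flip: Wf dsum_norm_W)
  qed (rule f_add)
  then have B: "blinfun_apply (Blinfun f) = f" by (rule bounded_linear_Blinfun_apply)
  show thesis
  proof
    show "Blinfun f \<in> bounded_ops" by (simp add: bounded_ops_def B f_scale)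
    show "unitary_conj k r W (Blinfun f) = T"
    proof (rule extensionalityI[OF _ ext])
      show "unitary_conj k r W (Blinfun f) v = T v" if v: "v \<in> dsum k r" for v
      proof -
        obtain x where "v = W x" using W_surj v by blast
        then show ?thesis by (simp add: B Wf)
      qed
    qed (simp add: unitary_conj_def)
  qed
qed

text \<open>Totality of the basis enters twice: once for the adjoints applied to basis vectors, and once
  for the operators themselves.\<close>

lemma bounded_ops_eqI:
  assumes A: "A \<in> bounded_ops" and B: "B \<in> bounded_ops"
    and eq: "\<And>i j a b. enat i < k \<Longrightarrow> enat j < k \<Longrightarrow> a < r \<Longrightarrow> b < r \<Longrightarrow>
      cinner (A (u j b)) (u i a) = cinner (B (u j b)) (u i a)"
  shows "A = B"
proof (rule blinfun_eqI)
  fix x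
  have adj: "cadjoint A (u i a) = cadjoint B (u i a)" if i: "enat i < k" "a < r" for i a
  proof -
    have "cinner (cadjoint A (u i a) - cadjoint B (u i a)) (u j b) = 0" if "enat j < k" "b < r" for j b
    proof -
      have "cinner (u j b) (cadjoint A (u i a) - cadjoint B (u i a)) = 0"
        using eq[OF i(1) that(1) i(2) that(2)]
        by (simp add: cinner_diff_right cadjoint_works[OF A] cadjoint_works[OF B])
      then show ?thesis by (rule cinner_eq_0_commute[THEN iffD1])
    qed
    then have "cadjoint A (u i a) - cadjoint B (u i a) = 0" by (rule total)
    then show ?thesis by simp
  qed
  have "cinner (A x - B x) (u i a) = 0" if "enat i < k" "a < r" for i a
    using adj[OF that] by (simp add: cinner_diff_left cadjoint_works[OF A] cadjoint_works[OF B])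
  then have "A x - B x = 0" by (rule total)
  then show "A x = B x" by simp
qed

lemma block_unitary_conj:
  assumes "enat j < k"
  shows "block r (unitary_conj k r W A) i j = Matrix.mat r r (\<lambda>(a, b). cinner (A (u j b)) (u i a))"
proof -
  have Wu: "(\<lambda>l. if l = j then unit_vec r b else 0\<^sub>v r) = W (u j b)" if "b < r" for b
    using assms that by (intro ext eq_vecI) (auto simp: orthonormal_blocks)
  show ?thesis
    unfolding block_def by (rule eq_matI) (simp_all add: Wu)
qed

end

section \<open>The block decomposition of the semigroup\<close>

lemma mat_adjoint_index:
  fixes A :: "complex mat"
  assumes "A \<in> carrier_mat r r" "i < r" "j < r"
  shows "mat_adjoint A $$ (i, j) = cnj (A $$ (j, i))"
  using assms by (simp add: mat_adjoint_def mat_of_rows_index cols_nth)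

lemma mat_adjoint_carrier: "A \<in> carrier_mat r r \<Longrightarrow> mat_adjoint A \<in> carrier_mat r r"
  by (auto simp: mat_adjoint_def)

locale block_decomposition = semigroup_with_minimal_projection +
  fixes k :: enat and r :: nat and e :: "nat \<Rightarrow> 'a" and D :: "nat \<Rightarrow> 'a \<Rightarrow>\<^sub>L 'a"
  assumes k_pos: "1 \<le> k"
    and e_orthonormal: "a < r \<Longrightarrow> b < r \<Longrightarrow> cinner (e a) (e b) = (if a = b then 1 else 0)"
    and e_P: "a < r \<Longrightarrow> P (e a) = e a"
    and e_expansion: "P x = x \<Longrightarrow> x = (\<Sum>a<r. scaleC (cinner x (e a)) (e a))"
    and D_columns: "enat i < k \<Longrightarrow> D i \<in> columns"
    and D_zero: "\<not> enat i < k \<Longrightarrow> D i = 0"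
    and D_orthogonal: "enat i < k \<Longrightarrow> enat j < k \<Longrightarrow> i \<noteq> j \<Longrightarrow> cadjoint (D i) o\<^sub>L D j = 0"
    and D_total: "(\<And>i. enat i < k \<Longrightarrow> cadjoint (D i) w = 0) \<Longrightarrow> w = 0"
begin

lemma cinner_D:
  assumes "enat i < k"
  shows "cinner x (D i y) = cinner (cadjoint (D i) x) y"
  by (rule cadjoint_works_right[OF columnsD(6)[OF D_columns[OF assms]]])

lemma D_adjoint_D:
  assumes "enat i < k" "enat j < k"
  shows "cadjoint (D i) (D j x) = (if i = j then P x else 0)"
proof -
  have "cadjoint (D i) o\<^sub>L D j = (if i = j then P else 0)"
    using assms by (simp add: D_orthogonal columns_cadjoint_left[OF D_columns])
  then show ?thesis by (metis blinfun_apply_blinfun_compose zero_blinfun.rep_eq)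
qed

lemma P_D_adjoint: "enat i < k \<Longrightarrow> P (cadjoint (D i) x) = cadjoint (D i) x"
  by (metis columns_cadjoint_P[OF D_columns] blinfun_apply_blinfun_compose)

sublocale block_basis k r "\<lambda>i b. D i (e b)"
proof
  show "cinner (D i (e a)) (D j (e b)) = (if i = j \<and> a = b \<and> enat i < k then 1 else 0)"
    if "a < r" "b < r" for a b i j
  proof (cases "enat i < k \<and> enat j < k")
    case True
    then show ?thesis using that by (auto simp: cinner_D D_adjoint_D e_P e_orthonormal)
  next
    case False
    then have "D i = 0 \<or> D j = 0" "\<not> (i = j \<and> enat i < k)" by (auto simp: D_zero)
    then show ?thesis by auto
  qed
  show "x = 0" if x: "\<And>i b. enat i < k \<Longrightarrow> b < r \<Longrightarrow> cinner x (D i (e b)) = 0" for x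
  proof (rule D_total)
    fix i assume i: "enat i < k"
    have "cadjoint (D i) x = (\<Sum>a<r. scaleC (cinner (cadjoint (D i) x) (e a)) (e a))"
      by (rule e_expansion[OF P_D_adjoint[OF i]])
    also have "\<dots> = 0" using x[OF i] by (simp add: cinner_D[OF i])
    finally show "cadjoint (D i) x = 0" .
  qed
qed

definition corner_matrix :: "('a \<Rightarrow>\<^sub>L 'a) \<Rightarrow> complex mat" where
  "corner_matrix X = Matrix.mat r r (\<lambda>(a, b). cinner (X (e b)) (e a))"

lemma corner_matrix_carrier [simp]: "corner_matrix X \<in> carrier_mat r r"
  by (simp add: corner_matrix_def)

lemma corner_matrix_index [simp]:
  "a < r \<Longrightarrow> b < r \<Longrightarrow> corner_matrix X $$ (a, b) = cinner (X (e b)) (e a)"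
  by (simp add: corner_matrix_def)

lemma corner_matrix_dim [simp]: "dim_row (corner_matrix X) = r" "dim_col (corner_matrix X) = r"
  by (simp_all add: corner_matrix_def)

lemma corner_matrix_compose:
  assumes X: "X \<in> bounded_ops" and Y: "P o\<^sub>L Y = Y"
  shows "corner_matrix (X o\<^sub>L Y) = corner_matrix X * corner_matrix Y"
proof (rule eq_matI)
  fix a b assume "a < dim_row (corner_matrix X * corner_matrix Y)"
    "b < dim_col (corner_matrix X * corner_matrix Y)"
  then have ab: "a < r" "b < r" by simp_all
  have "Y (e b) = (\<Sum>c<r. scaleC (cinner (Y (e b)) (e c)) (e c))"
    by (rule e_expansion) (metis Y blinfun_apply_blinfun_compose)
  then have "X (Y (e b)) = (\<Sum>c<r. scaleC (cinner (Y (e b)) (e c)) (X (e c)))"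
    by (metis (no_types, lifting) X blinfun.sum_right bounded_opsD sum.cong)
  then have "cinner (X (Y (e b))) (e a) = (\<Sum>c<r. cinner (Y (e b)) (e c) * cinner (X (e c)) (e a))"
    by (simp add: cinner_sum_left cinner_scaleC_left)
  then show "corner_matrix (X o\<^sub>L Y) $$ (a, b) = (corner_matrix X * corner_matrix Y) $$ (a, b)"
    using ab by (simp add: scalar_prod_def atLeast0LessThan mult.commute)
qed simp_all

lemma corner_matrix_P: "corner_matrix P = 1\<^sub>m r"
  by (rule eq_matI) (simp_all add: e_P e_orthonormal)

lemma corner_matrix_zero: "corner_matrix 0 = 0\<^sub>m r r"
  by (rule eq_matI) simp_all

lemma corner_matrix_cadjoint:
  assumes "X \<in> bounded_ops"
  shows "corner_matrix (cadjoint X) = mat_adjoint (corner_matrix X)"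
proof (rule eq_matI)
  fix a b assume "a < dim_row (mat_adjoint (corner_matrix X))" "b < dim_col (mat_adjoint (corner_matrix X))"
  then have ab: "a < r" "b < r"
    using mat_adjoint_carrier[OF corner_matrix_carrier, of X] by auto
  have "cinner (cadjoint X (e b)) (e a) = cnj (cinner (X (e a)) (e b))"
    by (metis assms cadjoint_works_right cinner_commute)
  then show "corner_matrix (cadjoint X) $$ (a, b) = mat_adjoint (corner_matrix X) $$ (a, b)"
    using ab by (simp add: mat_adjoint_index[OF corner_matrix_carrier])
qed (use mat_adjoint_carrier[OF corner_matrix_carrier, of X] in auto)

definition U :: "complex mat set" where
  "U = corner_matrix ` corner"

lemma corner_bounded_ops: "X \<in> corner \<Longrightarrow> X \<in> bounded_ops"
  by (simp add: corner_def S_bounded_ops)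

lemma corner_compose:
  assumes X: "X \<in> corner" and Y: "Y \<in> corner"
  shows "X o\<^sub>L Y \<in> corner"
proof -
  have "cadjoint X o\<^sub>L (X o\<^sub>L Y) = Y"
    using corner_unitary(1)[OF X] Y by (simp add: corner_def flip: blinfun_compose_assoc)
  then have "X o\<^sub>L Y \<noteq> 0" using Y by (auto simp: corner_def)
  moreover have "P o\<^sub>L (X o\<^sub>L Y) = X o\<^sub>L Y"
    using X by (simp add: corner_def flip: blinfun_compose_assoc)
  moreover have "(X o\<^sub>L Y) o\<^sub>L P = X o\<^sub>L Y"
    using Y by (simp add: corner_def blinfun_compose_assoc)
  ultimately show ?thesis using X Y by (simp add: corner_def S_compose)
qed

lemma U_group: "unitary_matrix_group r U"
  unfolding unitary_matrix_group_def U_def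
proof (intro conjI ballI; (elim imageE)?; hypsubst?)
  fix X assume X: "X \<in> corner"
  note X' = corner_unitary[OF X]
  have PX: "P o\<^sub>L X = X" "P o\<^sub>L cadjoint X = cadjoint X"
    using X X'(3) by (simp_all add: corner_def)
  show "unitary_matrix r (corner_matrix X)"
    unfolding unitary_matrix_def
    by (simp flip: corner_matrix_cadjoint[OF corner_bounded_ops[OF X]] corner_matrix_P
        corner_matrix_compose[OF corner_bounded_ops[OF X'(3)] PX(1)]
        corner_matrix_compose[OF corner_bounded_ops[OF X] PX(2)] add: X')
  show "mat_adjoint (corner_matrix X) \<in> corner_matrix ` corner"
    using X'(3) corner_matrix_cadjoint[OF corner_bounded_ops[OF X]] by (metis imageI)
next
  fix X Y assume X: "X \<in> corner" and Y: "Y \<in> corner"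
  have "P o\<^sub>L Y = Y" using Y by (simp add: corner_def)
  then show "corner_matrix X * corner_matrix Y \<in> corner_matrix ` corner"
    using corner_compose[OF X Y] corner_matrix_compose[OF corner_bounded_ops[OF X]] by (metis imageI)
next
  have "P \<in> corner" by (simp add: corner_def P_S P_nonzero PP)
  then show "1\<^sub>m r \<in> corner_matrix ` corner" using corner_matrix_P by (metis imageI)
qed

text \<open>An invariant subspace of the matrix group corresponds, by forming linear combinations of the
  basis \<open>e\<close>, to a subspace of the range of \<open>P\<close> invariant under the corner.\<close>

definition combination :: "complex Matrix.vec \<Rightarrow> 'a" where
  "combination v = (\<Sum>b<r. scaleC (vec_index v b) (e b))"

lemma cinner_combination: "a < r \<Longrightarrow> cinner (combination v) (e a) = vec_index v a"
proof -
  assume a: "a < r"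
  have "cinner (combination v) (e a) = (\<Sum>b<r. if b = a then vec_index v b else 0)"
    unfolding combination_def cinner_sum_left cinner_scaleC_left
    using a by (intro sum.cong) (auto simp: e_orthonormal)
  then show ?thesis using a by simp
qed

lemma P_combination: "P (combination v) = combination v"
  by (simp add: combination_def blinfun.sum_right bounded_opsD[OF P_bounded] e_P)

lemma combination_inj: "inj_on combination (carrier_vec r)"
  by (rule inj_onI, rule eq_vecI) (auto simp flip: cinner_combination)

lemma combination_coordinates: "P x = x \<Longrightarrow> combination (Matrix.vec r (\<lambda>a. cinner x (e a))) = x"
  unfolding combination_def by (subst (2) e_expansion) auto

lemma corner_combination:
  assumes X: "X \<in> corner" and v: "v \<in> carrier_vec r"
  shows "X (combination v) = combination (corner_matrix X *\<^sub>v v)"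
proof -
  have "P (X (combination v)) = X (combination v)"
    using X unfolding corner_def by (metis (mono_tags, lifting) blinfun_apply_blinfun_compose mem_Collect_eq)
  moreover have "Matrix.vec r (\<lambda>a. cinner (X (combination v)) (e a)) = corner_matrix X *\<^sub>v v"
  proof (rule eq_vecI)
    fix a assume "a < dim_vec (corner_matrix X *\<^sub>v v)"
    then have a: "a < r" by simp
    then show "vec_index (Matrix.vec r (\<lambda>a. cinner (X (combination v)) (e a))) a =
        vec_index (corner_matrix X *\<^sub>v v) a"
      using v by (simp add: combination_def blinfun.sum_right bounded_opsD[OF corner_bounded_ops[OF X]]
          cinner_sum_left cinner_scaleC_left scalar_prod_def atLeast0LessThan mult.commute)
  qed simp
  ultimately show ?thesis using combination_coordinates by metis
qed

lemma range_P_eq: "range (blinfun_apply P) = combination ` carrier_vec r"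
proof
  show "range P \<subseteq> combination ` carrier_vec r"
    by (metis PP_apply combination_coordinates image_eqI image_subsetI vec_carrier)
  show "combination ` carrier_vec r \<subseteq> range P" by (metis P_combination image_subsetI rangeI)
qed

text \<open>If the subspace is proper, some \<open>w \<noteq> 0\<close> in the range of \<open>P\<close> is orthogonal to it.  But the orbit under the
  corner of a non-zero vector of the subspace is not orthogonal to \<open>w\<close>.\<close>

lemma U_irreducible: "irreducible_matrices r U"
  unfolding irreducible_matrices_def
proof (rule notI, elim exE conjE)
  fix M
  assume "VectorSpace.subspace class_ring M (module_vec TYPE(complex) r)"
    and M0: "M \<noteq> {0\<^sub>v r}" and M1: "M \<noteq> carrier_vec r" and inv: "\<forall>A\<in>U. \<forall>v\<in>M. A *\<^sub>v v \<in> M"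
  then have sub: "submodule class_ring M (module_vec TYPE(complex) r)"
    by (simp add: VectorSpace.subspace_def)
  have Mc: "M \<subseteq> carrier_vec r" and Mz: "0\<^sub>v r \<in> M"
    and Madd: "\<And>v w. v \<in> M \<Longrightarrow> w \<in> M \<Longrightarrow> v + w \<in> M"
    and Msmult: "\<And>c v. v \<in> M \<Longrightarrow> c \<cdot>\<^sub>v v \<in> M"
    using submodule.subset[OF sub] submodule.zero_closed[OF sub] submodule.m_closed[OF sub]
      submodule.smult_closed[OF sub] by (simp_all add: module_vec_simps class_ring_simps)
  let ?N = "combination ` M"
  have comb_add: "combination (v + w) = combination v + combination w"
    if "v \<in> M" "w \<in> M" for v w
    using that Mc by (auto simp: combination_def cvec.scale_left_distrib sum.distrib)
  have comb_smult: "combination (c \<cdot>\<^sub>v v) = scaleC c (combination v)" if "v \<in> M" for c v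
    using that Mc by (auto simp: combination_def cvec.scale_sum_right scaleC_scaleC)
  have comb_zero: "combination (0\<^sub>v r) = 0" by (simp add: combination_def)
  have Nsub: "csubspace ?N"
    unfolding cvec.subspace_def
    using comb_zero Mz comb_add Madd comb_smult Msmult by (auto simp: image_iff) metis+
  have "?N \<subset> range P"
    unfolding range_P_eq using Mc M1 combination_inj by (metis inj_on_image_eq_iff image_mono psubsetI order_refl)
  moreover have "finite_dim (range P)" by (rule finite_rankD[OF minimalD(4)[OF P_minimal]])
  ultimately obtain w where w: "w \<in> range P" "w \<noteq> 0" "\<And>y. y \<in> ?N \<Longrightarrow> cinner y w = 0"
    using orthogonal_vector_exists[OF Nsub _ csubspace_range[OF P_bounded]] by metis
  obtain v where v: "v \<in> M" "v \<noteq> 0\<^sub>v r" using M0 Mz by blast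
  have "combination v \<noteq> 0"
    using v Mc combination_inj comb_zero by (metis inj_onD subsetD zero_carrier_vec)
  moreover have "P w = w" using w(1) by auto
  ultimately obtain X where X: "X \<in> corner" "cinner (X (combination v)) w \<noteq> 0"
    using corner_orbit_not_orthogonal[OF P_combination _ _ w(2)] by blast
  have "X (combination v) \<in> ?N"
    using corner_combination[OF X(1)] inv v Mc X(1) by (auto simp: U_def)
  then show False using w(3) X(2) by blast
qed

lemma block_eq:
  assumes "enat i < k" "enat j < k"
  shows "block r (unitary_conj k r W A) i j = corner_matrix (cadjoint (D i) o\<^sub>L (A o\<^sub>L D j))"
  unfolding block_unitary_conj[OF assms(2)] corner_matrix_def
  by (simp add: cinner_D[OF assms(1)])

lemma conj_in_S1_ops:
  assumes A: "A \<in> S"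
  shows "unitary_conj k r W A \<in> S1_ops k r U"
proof -
  define entry where "entry i j = cadjoint (D i) o\<^sub>L (A o\<^sub>L D j)" for i j
  define Q :: "nat \<Rightarrow> nat \<Rightarrow> complex" where
    "Q i j = (if enat i < k \<and> enat j < k \<and> entry i j \<noteq> 0 then 1 else 0)" for i j
  have Q: "enat i < k \<and> enat j < k \<and> entry i j \<noteq> 0" if "Q i j \<noteq> 0" for i j
    using that by (simp add: Q_def split: if_splits)
  have entry: "entry i j \<in> corner" if "enat i < k" "enat j < k" "entry i j \<noteq> 0" for i j
    unfolding entry_def using that A
    by (intro entry_in_corner D_columns) (simp_all add: entry_def)
  have "j = j'" if "Q i j \<noteq> 0" "Q i j' \<noteq> 0" for i j j'
  proof (rule ccontr)
    assume ne: "j \<noteq> j'"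
    have e: "entry i j = (cadjoint (D i) o\<^sub>L A) o\<^sub>L D j" for i j
      by (simp add: entry_def blinfun_compose_assoc)
    show False
    proof (rule row_entry_unique)
      show "cadjoint (D i) o\<^sub>L A \<in> S"
        using Q[OF that(1)] A by (intro S_compose columns_cadjoint_S D_columns) auto
    qed (use Q[OF that(1)] Q[OF that(2)] D_orthogonal[OF _ _ ne] entry D_columns in \<open>auto simp flip: e\<close>)
  qed
  moreover have "i = i'" if "Q i j \<noteq> 0" "Q i' j \<noteq> 0" for i i' j
  proof (rule ccontr)
    assume ne: "i \<noteq> i'"
    note 1 = Q[OF that(1)] and 2 = Q[OF that(2)]
    have col: "A o\<^sub>L D j \<in> columns"
      using 1 A columnsD[OF D_columns[of j]]
      by (auto simp: columns_def entry_def blinfun_compose_assoc intro!: S_compose)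
    show False
      by (rule column_entry_unique[OF D_columns D_columns D_orthogonal[OF _ _ ne] col])
        (use 1 2 in \<open>auto simp: entry_def\<close>)
  qed
  ultimately have "Q \<in> S1 k"
    by (auto simp: S1_def zero_one_matrices_def Q_def split: if_splits)
  moreover have "if Q i j = 0 then block r (unitary_conj k r W A) i j = 0\<^sub>m r r
      else block r (unitary_conj k r W A) i j \<in> U" if "enat i < k" "enat j < k" for i j
    using that entry[OF that]
    by (auto simp: block_eq Q_def corner_matrix_zero U_def simp flip: entry_def)
  ultimately show ?thesis
    unfolding block_ops_def using unitary_conj_dsum_ops[OF S_bounded_ops[OF A]] by blast
qed

text \<open>With two blocks available, zero is the product of an adjoint column and an orthogonal column.\<close>

lemma zero_in_S_unless_one: "k \<noteq> 1 \<Longrightarrow> 0 \<in> S"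
proof -
  assume "k \<noteq> 1"
  then have "1 < k" using k_pos by simp
  moreover have "enat 0 < 1" by (simp add: one_enat_def)
  ultimately have "enat 0 < k" "enat 1 < k"
    using order_less_trans unfolding one_enat_def by blast+
  then show "0 \<in> S"
    using D_orthogonal[of 0 1] columns_cadjoint_S[OF D_columns[of 0]] columnsD(1)[OF D_columns[of 1]]
    by (metis S_compose zero_neq_one)
qed

text \<open>The operator whose only non-zero block is \<open>X\<close> at position \<open>(i, j)\<close> is \<open>D\<^sub>i X D\<^sub>j\<^sup>*\<close>.\<close>

lemma S0_ops_subset: "S0_ops k r U \<subseteq> unitary_conj k r W ` (if k = 1 then insert 0 S else S)"
proof
  fix T assume "T \<in> S0_ops k r U"
  then obtain Q where T: "T \<in> dsum_ops k r" and Q: "Q \<in> S0 k"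
    and blocks: "\<And>i j. enat i < k \<Longrightarrow> enat j < k \<Longrightarrow>
      if Q i j = 0 then block r T i j = 0\<^sub>m r r else block r T i j \<in> U"
    unfolding block_ops_def by blast
  obtain A where A: "A \<in> bounded_ops" "unitary_conj k r W A = T"
    by (rule dsum_ops_unitary_conj[OF T])
  have entries: "cinner (A (D j (e b))) (D i (e a)) = block r T i j $$ (a, b)"
    if "enat i < k" "enat j < k" "a < r" "b < r" for i j a b
    using that unfolding A(2)[symmetric] by (simp add: block_eq cinner_D)
  have "A \<in> (if k = 1 then insert 0 S else S)"
  proof (cases "\<exists>i j. Q i j \<noteq> 0")
    case False
    have "A = 0"
      by (rule bounded_ops_eqI[OF A(1)])
        (use False blocks in \<open>auto simp: entries bounded_ops_def\<close>)
    then show ?thesis using zero_in_S_unless_one by simp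
  next
    case True
    then obtain i j where Qij: "Q i j \<noteq> 0" by blast
    then have ij: "enat i < k" "enat j < k" and uniq: "\<And>i' j'. Q i' j' \<noteq> 0 \<Longrightarrow> i' = i \<and> j' = j"
      using Q by (auto simp: S0_def zero_one_matrices_def)
    obtain X where X: "X \<in> corner" "block r T i j = corner_matrix X"
      using blocks[OF ij] Qij by (auto simp: U_def)
    have XP: "P (X x) = X x" "X (P x) = X x" for x
      using X(1) unfolding corner_def by (metis (mono_tags, lifting) blinfun_apply_blinfun_compose mem_Collect_eq)+
    define B where "B = D i o\<^sub>L (X o\<^sub>L cadjoint (D j))"
    have BS: "B \<in> S"
      unfolding B_def using X(1) columnsD(1)[OF D_columns[OF ij(1)]] columns_cadjoint_S[OF D_columns[OF ij(2)]]
      by (intro S_compose) (auto simp: corner_def)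
    have "A = B"
    proof (rule bounded_ops_eqI[OF A(1) S_bounded_ops[OF BS]])
      fix i' j' a b
      assume *: "enat i' < k" "enat j' < k" "a < r" "b < r"
      have "cinner (B (D j' (e b))) (D i' (e a)) =
          (if i' = i \<and> j' = j then cinner (X (e b)) (e a) else 0)"
        using * ij by (auto simp: B_def cinner_D D_adjoint_D XP)
      moreover have "block r T i' j' $$ (a, b) = (if i' = i \<and> j' = j then cinner (X (e b)) (e a) else 0)"
      proof (cases "i' = i \<and> j' = j")
        case True
        then show ?thesis using * X(2) by simp
      next
        case False
        then have "Q i' j' = 0" using uniq by blast
        then have "block r T i' j' = 0\<^sub>m r r" using blocks[OF *(1,2)] by simp
        then show ?thesis using False * by auto
      qed
      ultimately show "cinner (A (D j' (e b))) (D i' (e a)) = cinner (B (D j' (e b))) (D i' (e a))"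
        by (simp add: entries[OF *])
    qed
    then show ?thesis using BS by simp
  qed
  then show "T \<in> unitary_conj k r W ` (if k = 1 then insert 0 S else S)"
    unfolding A(2)[symmetric] by (rule imageI)
qed

end

lemma (in semigroup_with_minimal_projection) block_decomposition_exists:
  assumes "separable_space (euclidean :: 'a topology)"
  obtains k r e D where "block_decomposition S P k r e D" "enat r = min_rank"
proof -
  define r where "r = cdim (range (blinfun_apply P))"
  have fin: "finite_dim (range P)" by (rule finite_rankD[OF minimalD(4)[OF P_minimal]])
  obtain e where e:
    "\<And>a b. a < r \<Longrightarrow> b < r \<Longrightarrow> cinner (e a) (e b) = (if a = b then 1 else 0)"
    "\<And>a. a < r \<Longrightarrow> e a \<in> range P"
    "\<And>x. x \<in> range P \<Longrightarrow> x = (\<Sum>a<r. scaleC (cinner x (e a)) (e a))"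
    unfolding r_def
    by (rule orthonormal_basis_exists[OF fin csubspace_range[OF P_bounded]]) blast
  obtain k D where kD: "1 \<le> k" "\<And>i. enat i < k \<Longrightarrow> D i \<in> columns" "\<And>i. \<not> enat i < k \<Longrightarrow> D i = 0"
    "\<And>i j. enat i < k \<Longrightarrow> enat j < k \<Longrightarrow> i \<noteq> j \<Longrightarrow> cadjoint (D i) o\<^sub>L D j = 0"
    "\<And>w. (\<And>i. enat i < k \<Longrightarrow> cadjoint (D i) w = 0) \<Longrightarrow> w = 0"
    by (rule orthogonal_columns_exist[OF assms]) blast
  have "block_decomposition S P k r e D"
  proof
    show "P (e a) = e a" if "a < r" for a using e(2)[OF that] by auto
    show "x = (\<Sum>a<r. scaleC (cinner x (e a)) (e a))" if "P x = x" for x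
      by (rule e(3)) (metis that rangeI)
  qed (fact e(1) kD)+
  moreover have "enat r = min_rank"
    using minimalD(3)[OF P_minimal] operator_rank_eq[OF fin] by (simp add: r_def)
  ultimately show thesis by (rule that)
qed

theorem theorem3p11:
  fixes S :: "('a::{complex_inner, complete_space} \<Rightarrow>\<^sub>L 'a) set"
  assumes "separable_space (euclidean :: 'a topology)"
    and "operator_semigroup S"
    and "irreducible_ops S"
    and "closed S"
    and "\<forall>A\<in>S. partial_isometry A"
    and "\<exists>A\<in>S. A \<noteq> 0 \<and> compact_operator A"
  shows "\<exists>(k::enat) (r::nat) (U::complex mat set) (W::'a \<Rightarrow> nat \<Rightarrow> complex Matrix.vec).
    1 \<le> k \<and>
    unitary_matrix_group r U \<and> irreducible_matrices r U \<and>
    unitary_onto_dsum k r W \<and>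
    S0_ops k r U \<subseteq> unitary_conj k r W ` (if k = 1 then insert 0 S else S) \<and>
    unitary_conj k r W ` S \<subseteq> S1_ops k r U \<and>
    enat r = (LEAST n. n \<in> operator_rank ` S \<and> n \<noteq> 0)"
proof -
  interpret partial_isometry_semigroup S
    using assms(2-6) compact_partial_isometry_finite_rank by unfold_locales blast+
  obtain P where "minimal_projection P" using minimal_projection_exists by blast
  then interpret semigroup_with_minimal_projection S P by unfold_locales
  obtain k r e D where dec: "block_decomposition S P k r e D" and r: "enat r = min_rank"
    by (rule block_decomposition_exists[OF assms(1)])
  interpret block_decomposition S P k r e D by (rule dec)
  show ?thesis
    using k_pos U_group U_irreducible unitary_W S0_ops_subset conj_in_S1_ops r
    unfolding min_rank_def by blast
qed

end
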